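(* Let $p\ge 1$ and let $G=\mathrm{SL}(n)$ or $G=\mathrm{Sp}(2s)$ (for $n=2s$). Then the algebra of invariants $F_n(\mathfrak N_p)^G$ is finite-dimensional. More precisely, the Hilbert series $H(F_n(\mathfrak N_p)^G,t)$ is a polynomial and it holds that $$\deg H(F_n(\mathfrak N_p)^G,t)\le n(p-1),$$ where in the case $G=\mathrm{Sp}(2s)$ we have $n=2s$.
   Context: $V$ is a finite-dimensional vector space over $\mathbb C$ with basis $X=\{x_1,\dots,x_n\}$, and $\mathbb C\langle X\rangle$ is the free associative algebra on $X$, identified with the tensor algebra $T(V)$. Left-normed commutators: $[u_1,u_2]=u_1u_2-u_2u_1$ and $[u_1,\dots,u_i]=[[u_1,\dots,u_{i-1}],u_i]$ for $i\ge 3$. For $m\ge 2$, $I_m$ is the two-sided ideal of $\mathbb C\langle X\rangle$ generated by all commutators $[u_1,\dots,u_m]$ with $u_1,\dots,u_m\in\mathbb C\langle X\rangle$, and $F_n(\mathfrak N_p)=\mathbb C\langle X\rangle/I_{p+1}$. $\mathrm{GL}(n)=\mathrm{GL}(V,\mathbb C)$ acts on $V$ and, diagonally by algebra automorphisms, on $\mathbb C\langle X\rangle$ and on the quotient $F_n(\mathfrak N_p)$. $\mathrm{SL}(n)=\mathrm{SL}(V,\mathbb C)$, and for $n=2s$, $\mathrm{Sp}(2s)=\mathrm{Sp}(V,\mathbb C)$ is the subgroup preserving a fixed non-degenerate skew-symmetric bilinear form on $V$. $F_n(\mathfrak N_p)$ is graded by total degree (each $x_i$ of degree $1$), with homogeneous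 components $F_n^{(i)}(\mathfrak N_p)$, and $H(F_n(\mathfrak N_p)^G,t)=\sum_{i\ge0}\dim_{\mathbb C}\big(F_n^{(i)}(\mathfrak N_p)^G\big)t^i$.
   Formalization: The hypothesis n ≥ 2 is added: for n = 1 the group SL(1) is trivial and F_1(N_p) = C[x], so the algebra of invariants is C[x], which is infinite-dimensional, and the claim fails. *)

theory Defs
  imports
    "HOL-Analysis.Analysis"
    "HOL-Algebra.Embedded_Algebras"
    "HOL-Algebra.QuotRing"
    "HOL-Algebra.Algebraic_Closure_Type"
    "HOL-Library.Poly_Mapping"
    "HOL-Computational_Algebra.Polynomial_FPS"
begin

section \<open>The free associative algebra\<close>

text \<open>
  The free algebra on \<open>X = {x\<^sub>i | i :: 'n}\<close> is the monoid algebra of the free monoid of words in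
  \<open>X\<close>: multiplication of finitely supported functions in \<^theory>\<open>HOL-Library.Poly_Mapping\<close> is
  convolution with respect to the monoid written additively, here concatenation of words.
\<close>

datatype 'n free_monoid = Mon (letters: "'n list")

instantiation free_monoid :: (type) monoid_add
begin

definition zero_free_monoid :: "'a free_monoid" where
  "0 = Mon []"

definition plus_free_monoid :: "'a free_monoid \<Rightarrow> 'a free_monoid \<Rightarrow> 'a free_monoid" where
  "v + w = Mon (letters v @ letters w)"

instance
  by standard (simp_all add: zero_free_monoid_def plus_free_monoid_def)

end

type_synonym 'n free_algebra = "'n free_monoid \<Rightarrow>\<^sub>0 complex"

definition const :: "complex \<Rightarrow> 'n free_algebra" where
  "const c = Poly_Mapping.single 0 c"

definition var :: "'n \<Rightarrow> 'n free_algebra" where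
  "var i = Poly_Mapping.single (Mon [i]) 1"

definition homogeneous :: "nat \<Rightarrow> 'n free_algebra set" where
  "homogeneous d = {f. \<forall>w \<in> Poly_Mapping.keys f. length (letters w) = d}"

fun left_normed_commutator :: "'a::ring list \<Rightarrow> 'a" where
  "left_normed_commutator [] = 0"
| "left_normed_commutator (u # us) = foldl (\<lambda>a b. a * b - b * a) u us"

definition commutator_ideal :: "nat \<Rightarrow> 'n free_algebra set" where
  "commutator_ideal m =
     genideal ring_of_type_algebra {left_normed_commutator us |us. length us = m}"


section \<open>The relatively free algebra $F_n(\mathfrak{N}_p)$\<close>

text \<open>The elements of the quotient are the cosets of the ideal, so they have type
  \<^typ>\<open>'n free_algebra set\<close>.\<close>

definition rel_free :: "nat \<Rightarrow> 'n free_algebra set ring" where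
  "rel_free p = ring_of_type_algebra Quot commutator_ideal (p + 1)"

definition rel_free_proj :: "nat \<Rightarrow> 'n free_algebra \<Rightarrow> 'n free_algebra set" where
  "rel_free_proj p f = commutator_ideal (p + 1) +>\<^bsub>ring_of_type_algebra\<^esub> f"

text \<open>The copy of the complex numbers in the quotient. Dimensions over it, in the sense of
  \<^theory>\<open>HOL-Algebra.Embedded_Algebras\<close>, are the complex dimensions.\<close>

definition rel_free_scalars :: "nat \<Rightarrow> 'n free_algebra set set" where
  "rel_free_scalars p = rel_free_proj p ` range const"

definition rel_free_component :: "nat \<Rightarrow> nat \<Rightarrow> 'n free_algebra set set" where
  "rel_free_component p d = rel_free_proj p ` homogeneous d"


section \<open>Group actions and invariants\<close>

text \<open>The space \<open>V\<close> is \<^typ>\<open>complex^'n\<close>, with standard basis vectors corresponding to the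
  variables; a matrix \<open>g\<close> sends \<open>x\<^sub>j\<close> to the linear form whose coefficients are column \<open>j\<close>.\<close>

definition linear_form :: "complex^'n \<Rightarrow> 'n::finite free_algebra" where
  "linear_form v = (\<Sum>i\<in>UNIV. const (v $ i) * var i)"

definition act :: "complex^'n^'n \<Rightarrow> 'n::finite free_algebra \<Rightarrow> 'n free_algebra" where
  "act g f = (\<Sum>w\<in>Poly_Mapping.keys f. const (Poly_Mapping.lookup f w) *
     prod_list (map (\<lambda>j. linear_form (g *v axis j 1)) (letters w)))"

text \<open>Since the ideal is stable under the automorphism \<^term>\<open>act g\<close> for invertible \<open>g\<close>, the induced
  action on the quotient sends a coset to its image.\<close>

definition rel_free_invariants ::
    "nat \<Rightarrow> (complex^'n^'n) set \<Rightarrow> 'n::finite free_algebra set set" where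
  "rel_free_invariants p G = {A \<in> carrier (rel_free p). \<forall>g\<in>G. act g ` A = A}"

definition hilbert_series_invariants :: "nat \<Rightarrow> (complex^'n::finite^'n) set \<Rightarrow> int fps" where
  "hilbert_series_invariants p G = Abs_fps (\<lambda>d. int
     (ring.dim (rel_free p) (rel_free_scalars p)
       (rel_free_component p d \<inter> rel_free_invariants p G)))"

definition SL :: "(complex^'n::finite^'n) set" where
  "SL = {g. det g = 1}"

definition symplectic_form :: "(complex^'n::finite \<Rightarrow> complex^'n \<Rightarrow> complex) \<Rightarrow> bool" where
  "symplectic_form \<omega> \<longleftrightarrow>
     (\<forall>u. Vector_Spaces.linear (*s) (*) (\<lambda>v. \<omega> u v)) \<and>
     (\<forall>v. Vector_Spaces.linear (*s) (*) (\<lambda>u. \<omega> u v)) \<and>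
     (\<forall>u v. \<omega> u v = - \<omega> v u) \<and>
     (\<forall>u. (\<forall>v. \<omega> u v = 0) \<longrightarrow> u = 0)"

definition Sp :: "(complex^'n \<Rightarrow> complex^'n \<Rightarrow> complex) \<Rightarrow> (complex^'n::finite^'n) set" where
  "Sp \<omega> = {g. invertible g \<and> (\<forall>u v. \<omega> (g *v u) (g *v v) = \<omega> u v)}"

end

theory Submission
  imports Defs
begin

text \<open>
  Write \<open>I = I\<^bsub>p+1\<^esub>\<close>, let \<open>\<partial>\<^sub>x\<close> be the derivation with \<open>x \<mapsto> 1\<close> and \<open>F\<close> the derivation with \<open>x \<mapsto> y\<close>,
  both killing the other variables. The point is that an element \<open>f\<close> that is homogeneous
  of degree at least \<open>p\<close> in \<open>x\<close> lies in \<open>I\<close> as soon as \<open>\<partial>\<^sub>x f \<in> I\<close>: modulo \<open>I\<close> it then equals its Taylor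
  projection \<open>\<Sum>\<^sub>a (-x)\<^sup>a/a! \<partial>\<^sub>x\<^sup>a f\<close>, which turns every factor \<open>x\<close> of a word into a commutator
  with \<open>x\<close>. Since \<open>[\<partial>\<^sub>y, F] = \<partial>\<^sub>x\<close>, descending induction on the order of the derivatives of \<open>f\<close> in
  \<open>x\<close> and \<open>y\<close> replaces the hypothesis \<open>\<partial>\<^sub>x f \<in> I\<close> by \<open>F f \<in> I\<close>.

  An invariant is, modulo \<open>I\<close>, fixed by the transvections in \<open>G\<close>. For \<open>SL\<close> in the standard basis and for
  \<open>Sp\<close> in a symplectic basis, there is for every \<open>x\<close> some \<open>y\<close> for which all maps \<open>x \<mapsto> x + t y\<close> are such transvections,
  so \<open>F f \<in> I\<close>; as \<open>I\<close> is multigraded, this holds for each multihomogeneous component of \<open>f\<close>. A component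
  of total degree above \<open>n (p - 1)\<close> has degree at least \<open>p\<close> in some variable and therefore vanishes modulo \<open>I\<close>.
\<close>

section \<open>Two-sided ideals and the commutator ideals\<close>

text \<open>A carrier-free form of \<open>ideal\<close>; closure under negation is contained in the
  last clause, with \<open>r = -1\<close>.\<close>

definition two_sided_ideal :: "'a::ring_1 set \<Rightarrow> bool" where
  "two_sided_ideal I \<longleftrightarrow> 0 \<in> I \<and> (\<forall>a\<in>I. \<forall>b\<in>I. a + b \<in> I) \<and> (\<forall>a\<in>I. \<forall>r. r * a \<in> I \<and> a * r \<in> I)"

lemma two_sided_idealD:
  assumes "two_sided_ideal I"
  shows "0 \<in> I" "a \<in> I \<Longrightarrow> b \<in> I \<Longrightarrow> a + b \<in> I" "a \<in> I \<Longrightarrow> r * a \<in> I" "a \<in> I \<Longrightarrow> a * r \<in> I"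
    "a \<in> I \<Longrightarrow> - a \<in> I" "a \<in> I \<Longrightarrow> b \<in> I \<Longrightarrow> a - b \<in> I"
proof -
  show 1: "0 \<in> I" and 2: "\<And>a b. a \<in> I \<Longrightarrow> b \<in> I \<Longrightarrow> a + b \<in> I"
    and 3: "\<And>a r. a \<in> I \<Longrightarrow> r * a \<in> I" and "a \<in> I \<Longrightarrow> a * r \<in> I"
    using assms by (auto simp: two_sided_ideal_def)
  show 4: "- a \<in> I" if "a \<in> I" for a
    using 3[OF that, of "-1"] by simp
  show "a - b \<in> I" if "a \<in> I" "b \<in> I"
    using 2[OF that(1) 4[OF that(2)]] by simp
qed

lemma two_sided_ideal_sum:
  assumes "two_sided_ideal I" "\<And>i. i \<in> S \<Longrightarrow> f i \<in> I"
  shows "(\<Sum>i\<in>S. f i) \<in> I"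
  using assms(2) by (induction S rule: infinite_finite_induct) (auto intro: two_sided_idealD[OF assms(1)])

lemma ring_ring_of_type_algebra: "ring (ring_of_type_algebra :: 'a::ring_1 ring)"
proof -
  have "\<exists>y. x + y = 0" for x :: 'a
    using add.right_inverse by blast
  thus ?thesis
    unfolding ring_of_type_algebra_def using add.right_inverse
    by unfold_locales (auto simp: algebra_simps Units_def)
qed

lemma ring_of_type_algebra_simps [simp]:
  "carrier ring_of_type_algebra = (UNIV :: 'a::ring_1 set)"
  "x \<otimes>\<^bsub>ring_of_type_algebra\<^esub> y = (x * y :: 'a)"
  "x \<oplus>\<^bsub>ring_of_type_algebra\<^esub> y = (x + y :: 'a)"
  "\<one>\<^bsub>ring_of_type_algebra\<^esub> = (1 :: 'a)"
  "\<zero>\<^bsub>ring_of_type_algebra\<^esub> = (0 :: 'a)"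
  by (simp_all add: ring_of_type_algebra_def)

lemma ideal_iff_two_sided_ideal:
  "ideal I (ring_of_type_algebra :: 'a::ring_1 ring) \<longleftrightarrow> two_sided_ideal I"
proof
  assume "ideal I (ring_of_type_algebra :: 'a ring)"
  then interpret I: ideal I "ring_of_type_algebra :: 'a ring" .
  show "two_sided_ideal I"
    unfolding two_sided_ideal_def
    using additive_subgroup.zero_closed[OF I.additive_subgroup_axioms]
      additive_subgroup.a_closed[OF I.additive_subgroup_axioms] I.I_l_closed I.I_r_closed by simp
next
  assume I: "two_sided_ideal I"
  interpret R: ring "ring_of_type_algebra :: 'a ring" by (rule ring_ring_of_type_algebra)
  have inv: "\<ominus>\<^bsub>ring_of_type_algebra\<^esub> a = - a" for a :: 'a
    by (rule R.minus_equality) auto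
  show "ideal I (ring_of_type_algebra :: 'a ring)"
  proof (rule idealI)
    show "subgroup I (add_monoid ring_of_type_algebra)"
      by (rule R.add.subgroupI) (auto simp: inv inv[unfolded a_inv_def] intro: two_sided_idealD[OF I])
  qed (auto intro: two_sided_idealD[OF I] R.ring_axioms)
qed

lemma two_sided_ideal_commutator_ideal: "two_sided_ideal (commutator_ideal m)"
  unfolding commutator_ideal_def ideal_iff_two_sided_ideal[symmetric]
  by (rule ring.genideal_ideal[OF ring_ring_of_type_algebra]) simp

lemma left_normed_commutator_in_ideal:
  assumes "length us = m"
  shows "left_normed_commutator us \<in> commutator_ideal m"
  using assms ring.genideal_self[OF ring_ring_of_type_algebra]
  unfolding commutator_ideal_def by (metis (mono_tags, lifting) mem_Collect_eq ring_of_type_algebra_simps(1) subset_UNIV subsetD)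

text \<open>Serves as an induction principle: a property is propagated through the ideal by taking
  for \<open>J\<close> the set of elements that have it.\<close>

lemma commutator_ideal_minimal:
  assumes "two_sided_ideal J" "\<And>us. length us = m \<Longrightarrow> left_normed_commutator us \<in> J"
  shows "commutator_ideal m \<subseteq> J"
  unfolding commutator_ideal_def
  by (rule ring.genideal_minimal[OF ring_ring_of_type_algebra])
     (use assms in \<open>auto simp: ideal_iff_two_sided_ideal\<close>)

text \<open>The left fold peels entries off the right end. A commutator with one entry is that
  entry, hence the restriction to nonempty \<open>us\<close>.\<close>

lemma left_normed_commutator_snoc:
  assumes "us \<noteq> []"
  shows "left_normed_commutator (us @ [c]) =
    left_normed_commutator us * c - c * left_normed_commutator us"
  using assms by (cases us) auto

text \<open>Each longer generator is the bracket of a shorter one with its last entry.\<close>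

lemma commutator_ideal_mono: "commutator_ideal (Suc (Suc m)) \<subseteq> commutator_ideal (Suc m)"
proof (rule commutator_ideal_minimal[OF two_sided_ideal_commutator_ideal])
  note I = two_sided_idealD[OF two_sided_ideal_commutator_ideal]
  fix us :: "'a free_algebra list" assume us: "length us = Suc (Suc m)"
  then obtain vs c where vs: "us = vs @ [c]" "length vs = Suc m"
    by (metis length_Suc_conv_rev)
  then have "vs \<noteq> []" by auto
  then show "left_normed_commutator us \<in> commutator_ideal (Suc m)"
    using left_normed_commutator_in_ideal[OF vs(2)]
    by (simp add: vs(1) left_normed_commutator_snoc I(3,4,6))
qed

lemma commutator_ideal_antimono:
  assumes "m \<le> n"
  shows "commutator_ideal (Suc n) \<subseteq> commutator_ideal (Suc m)"
  using assms commutator_ideal_mono by (induction n rule: dec_induct) blast+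

section \<open>Words, linear maps and derivations\<close>

abbreviation word :: "'n list \<Rightarrow> 'n free_algebra" where
  "word l \<equiv> Poly_Mapping.single (Mon l) 1"

lemma const_simps [simp]:
  "const 0 = 0" "const 1 = 1" "const (a + b) = const a + const b" "const (a * b) = const a * const b"
  "const (- a) = - const a" "const (a - b) = const a - const b"
  by (simp_all add: const_def single_add mult_single single_uminus single_diff)

lemma const_of_nat: "const (of_nat n) = of_nat n"
  by (induction n) (auto simp: algebra_simps)

lemma word_Nil: "word [] = 1"
  by (metis single_one zero_free_monoid_def)

lemma word_mult: "word u * word v = word (u @ v)"
  by (simp add: mult_single plus_free_monoid_def)

lemma word_Cons: "word (i # l) = var i * word l"
  by (simp add: var_def word_mult)

lemma const_mult_single: "const a * Poly_Mapping.single w b = Poly_Mapping.single w (a * b)"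
  by (simp add: const_def mult_single)

lemma poly_mapping_decomp:
  "f = (\<Sum>w\<in>Poly_Mapping.keys f. Poly_Mapping.single w (Poly_Mapping.lookup f w))"
  by (rule poly_mapping_eqI)
     (auto simp: lookup_sum lookup_single when_def in_keys_iff sum.delta)

lemma free_algebra_decomp:
  "f = (\<Sum>w\<in>Poly_Mapping.keys f. const (Poly_Mapping.lookup f w) * word (letters w))"
  by (subst poly_mapping_decomp[of f]) (simp add: const_mult_single)

lemma const_commute: "const c * f = f * const c"
proof -
  have "const c * f = (\<Sum>w\<in>Poly_Mapping.keys f. const c * Poly_Mapping.single w (Poly_Mapping.lookup f w))"
    by (subst poly_mapping_decomp[of f]) (simp add: sum_distrib_left)
  also have "\<dots> = (\<Sum>w\<in>Poly_Mapping.keys f. Poly_Mapping.single w (Poly_Mapping.lookup f w) * const c)"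
    by (simp add: const_def mult_single mult.commute)
  also have "\<dots> = f * const c"
    by (simp only: sum_distrib_right[symmetric] poly_mapping_decomp[symmetric])
  finally show ?thesis .
qed

lemma const_left_commute: "f * (const c * g) = const c * (f * g)"
  by (metis const_commute mult.assoc)

lemma const_inverse:
  assumes "c \<noteq> 0"
  shows "const (inverse c) * (const c * f) = f"
  using assms by (simp add: mult.assoc[symmetric] const_simps(4)[symmetric] del: const_simps(4))

lemma two_sided_ideal_const_cancel:
  assumes "two_sided_ideal I" "const c * f \<in> I" "c \<noteq> 0"
  shows "f \<in> I"
  using two_sided_idealD(3)[OF assms(1,2), of "const (inverse c)"] const_inverse[OF assms(3), of f] by simp

lemma free_algebra_induct [case_names zero add word]:
  assumes "P 0" "\<And>f g. P f \<Longrightarrow> P g \<Longrightarrow> P (f + g)" "\<And>c l. P (const c * word l)"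
  shows "P f"
proof -
  have "P (\<Sum>w\<in>S. const (Poly_Mapping.lookup f w) * word (letters w))" for S
    by (induction S rule: infinite_finite_induct)
       (simp_all add: assms del: free_monoid.collapse)
  then show ?thesis using free_algebra_decomp[of f] by metis
qed

text \<open>The linear map with prescribed values on the basis of words. Derivations, the matrix
  action and the projections onto components all arise this way.\<close>

definition word_lift :: "('n list \<Rightarrow> 'n free_algebra) \<Rightarrow> 'n free_algebra \<Rightarrow> 'n free_algebra" where
  "word_lift \<phi> f = (\<Sum>w\<in>Poly_Mapping.keys f. const (Poly_Mapping.lookup f w) * \<phi> (letters w))"

lemma word_lift_superset:
  assumes "finite S" "Poly_Mapping.keys f \<subseteq> S"
  shows "word_lift \<phi> f = (\<Sum>w\<in>S. const (Poly_Mapping.lookup f w) * \<phi> (letters w))"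
  unfolding word_lift_def
  by (rule sum.mono_neutral_left) (use assms in \<open>auto simp: in_keys_iff\<close>)

lemma word_lift_add: "word_lift \<phi> (f + g) = word_lift \<phi> f + word_lift \<phi> g"
proof -
  let ?S = "Poly_Mapping.keys f \<union> Poly_Mapping.keys g"
  have "word_lift \<phi> h = (\<Sum>w\<in>?S. const (Poly_Mapping.lookup h w) * \<phi> (letters w))"
    if "h \<in> {f, g, f + g}" for h
    by (rule word_lift_superset) (use that keys_add[of f g] in auto)
  then show ?thesis by (simp add: lookup_add algebra_simps sum.distrib)
qed

lemma word_lift_word [simp]: "word_lift \<phi> (word l) = \<phi> l"
  by (simp add: word_lift_def)

lemma word_lift_const_word: "word_lift \<phi> (const c * word l) = const c * \<phi> l"
  by (cases "c = 0") (simp_all add: word_lift_def const_mult_single)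

lemma word_lift_const: "word_lift \<phi> (const c * f) = const c * word_lift \<phi> f"
proof (induction f rule: free_algebra_induct)
  case (word a l)
  then show ?case
    by (metis const_simps(4) mult.assoc word_lift_const_word)
qed (simp_all add: word_lift_add distrib_left, simp add: word_lift_def)

locale derivation =
  fixes d :: "'n free_algebra \<Rightarrow> 'n free_algebra"
  assumes add: "d (f + g) = d f + d g"
    and const_mult: "d (const c * f) = const c * d f"
    and leibniz: "d (f * g) = d f * g + f * d g"
begin

lemma zero [simp]: "d 0 = 0"
  using add[of 0 0] by simp

lemma minus: "d (- f) = - d f"
  using add[of f "- f"] by (simp add: eq_neg_iff_add_eq_0 add.commute)

lemma diff: "d (f - g) = d f - d g"
  using add[of f "- g"] by (simp add: minus)

lemma sum: "d (\<Sum>i\<in>S. f i) = (\<Sum>i\<in>S. d (f i))"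
  by (induction S rule: infinite_finite_induct) (auto simp: add)

lemma one [simp]: "d 1 = 0"
  using leibniz[of 1 1] by simp

lemma const [simp]: "d (const c) = 0"
  using const_mult[of c 1] by simp

text \<open>Since \<open>d [u, c] = [d u, c] + [u, d c]\<close>, peeling off the last entry produces
  one summand for each entry.\<close>

lemma left_normed_commutator:
  "us \<noteq> [] \<Longrightarrow> d (left_normed_commutator us) =
    (\<Sum>i<length us. left_normed_commutator (us[i := d (us ! i)]))"
proof (induction us rule: rev_induct)
  case (snoc c us)
  show ?case
  proof (cases "us = []")
    case False
    let ?l = "Defs.left_normed_commutator" and ?us = "us @ [c]"
    have upd: "?l (?us[i := d (?us ! i)]) = ?l (us[i := d (us ! i)]) * c - c * ?l (us[i := d (us ! i)])"
      if "i < length us" for i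
      using that False by (simp add: list_update_append nth_append left_normed_commutator_snoc)
    have "d (?l ?us) = (d (?l us) * c - c * d (?l us)) + ?l (us @ [d c])"
      unfolding left_normed_commutator_snoc[OF False] diff leibniz by (simp only: algebra_simps)
    also have "d (?l us) * c - c * d (?l us) = (\<Sum>i<length us. ?l (?us[i := d (?us ! i)]))"
      by (simp add: upd snoc.IH[OF False] sum_distrib_left sum_distrib_right sum_subtractf)
    finally show ?thesis by simp
  qed simp
qed simp

lemma commutator_ideal:
  assumes "f \<in> commutator_ideal (Suc m)"
  shows "d f \<in> commutator_ideal (Suc m)"
proof -
  note I = two_sided_idealD[OF two_sided_ideal_commutator_ideal[of "Suc m"]]
  \<comment> \<open>The set keeps membership in the ideal because in
    \<open>d (r * a) = d r * a + r * d a\<close> the first summand needs \<open>a\<close> itself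
    there.\<close>
  have "commutator_ideal (Suc m) \<subseteq> {f \<in> commutator_ideal (Suc m). d f \<in> commutator_ideal (Suc m)}"
  proof (rule commutator_ideal_minimal)
    show "two_sided_ideal {f \<in> commutator_ideal (Suc m). d f \<in> commutator_ideal (Suc m)}"
      unfolding two_sided_ideal_def by (simp add: add leibniz I)
  next
    fix us :: "'n free_algebra list" assume us: "length us = Suc m"
    then have "us \<noteq> []" by auto
    then have "d (Defs.left_normed_commutator us) \<in> commutator_ideal (Suc m)"
      unfolding left_normed_commutator[OF \<open>us \<noteq> []\<close>]
      by (intro two_sided_ideal_sum[OF two_sided_ideal_commutator_ideal] left_normed_commutator_in_ideal)
         (simp add: us)
    with us show "Defs.left_normed_commutator us \<in>
        {f \<in> commutator_ideal (Suc m). d f \<in> commutator_ideal (Suc m)}"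
      by (simp add: left_normed_commutator_in_ideal)
  qed
  with assms show ?thesis by blast
qed

end

text \<open>The Leibniz rule settles words and linearity the rest; operator identities below are
  therefore checked on variables only.\<close>

lemma derivation_eqI:
  assumes "derivation d" "derivation e" "\<And>i. d (var i) = e (var i)"
  shows "d f = e f"
proof -
  interpret d: derivation d by fact
  interpret e: derivation e by fact
  have "d (word l) = e (word l)" for l
    by (induction l) (auto simp: word_Nil word_Cons d.leibniz e.leibniz assms(3))
  then show ?thesis
    by (induction f rule: free_algebra_induct) (auto simp: d.add e.add d.const_mult e.const_mult)
qed

text \<open>The mixed terms \<open>d f * e g\<close> and \<open>e f * d g\<close> cancel in the
  difference.\<close>

lemma derivation_bracket:
  assumes "derivation d" "derivation e"
  shows "derivation (\<lambda>f. d (e f) - e (d f))"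
proof -
  interpret d: derivation d by fact
  interpret e: derivation e by fact
  show ?thesis
    by standard (auto simp: d.leibniz e.leibniz d.add e.add d.const_mult e.const_mult algebra_simps)
qed

lemma derivation_zero: "derivation (\<lambda>f. 0)"
  by standard auto

primrec derive_word :: "('n \<Rightarrow> 'n free_algebra) \<Rightarrow> 'n list \<Rightarrow> 'n free_algebra" where
  "derive_word \<delta> [] = 0"
| "derive_word \<delta> (i # l) = \<delta> i * word l + var i * derive_word \<delta> l"

definition deriv_ext :: "('n \<Rightarrow> 'n free_algebra) \<Rightarrow> 'n free_algebra \<Rightarrow> 'n free_algebra" where
  "deriv_ext \<delta> = word_lift (derive_word \<delta>)"

lemma derive_word_append:
  "derive_word \<delta> (u @ v) = derive_word \<delta> u * word v + word u * derive_word \<delta> v"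
  by (induction u) (auto simp: word_Nil word_Cons word_mult[symmetric] algebra_simps)

text \<open>The Leibniz rule for two words is extended by linearity, first in the right factor and
  then in the left.\<close>

lemma derivation_deriv_ext: "derivation (deriv_ext \<delta>)"
proof
  show add: "deriv_ext \<delta> (f + g) = deriv_ext \<delta> f + deriv_ext \<delta> g" for f g
    by (simp add: deriv_ext_def word_lift_add)
  show cm: "deriv_ext \<delta> (const c * f) = const c * deriv_ext \<delta> f" for c f
    by (simp add: deriv_ext_def word_lift_const)
  have z: "deriv_ext \<delta> 0 = 0"
    using add[of 0 0] by simp
  have w: "deriv_ext \<delta> (word u * word v) = deriv_ext \<delta> (word u) * word v + word u * deriv_ext \<delta> (word v)" for u v
    by (simp add: word_mult deriv_ext_def derive_word_append)
  have 1: "deriv_ext \<delta> (word u * g) = deriv_ext \<delta> (word u) * g + word u * deriv_ext \<delta> g" for u g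
  proof (induction g rule: free_algebra_induct)
    case (word c l)
    show ?case
      by (simp add: const_left_commute cm w distrib_left)
  qed (simp_all add: z add algebra_simps)
  show "deriv_ext \<delta> (f * g) = deriv_ext \<delta> f * g + f * deriv_ext \<delta> g" for f g
  proof (induction f rule: free_algebra_induct)
    case (word c l)
    show ?case
      by (simp add: cm 1 mult.assoc distrib_left)
  qed (simp_all add: z add algebra_simps)
qed

lemma deriv_ext_var [simp]: "deriv_ext \<delta> (var i) = \<delta> i"
  by (simp add: deriv_ext_def var_def word_Nil)

section \<open>Elements of high degree in one variable\<close>

text \<open>The two-sided ideal would be too large for \<open>comm_span_commutator\<close>: \<open>f = y [z, w]\<close> is in \<open>I\<^sub>2\<close>, but
  \<open>[f, x]\<close> is congruent to \<open>[y, x] [z, w]\<close> modulo \<open>I\<^sub>3\<close> and is not in \<open>I\<^sub>3\<close>. Only left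
  multiplication by \<open>x\<close> is allowed.\<close>

inductive comm_span :: "'a::ring_1 \<Rightarrow> nat \<Rightarrow> 'a \<Rightarrow> bool" for x q where
  comm: "length us = Suc q \<Longrightarrow> comm_span x q (left_normed_commutator us)"
| mult: "comm_span x q f \<Longrightarrow> comm_span x q (x * f)"
| add: "comm_span x q f \<Longrightarrow> comm_span x q g \<Longrightarrow> comm_span x q (f + g)"

text \<open>On a generator \<open>e\<close>, \<open>[e, x] c = [e, x c] - x [e, c]\<close>: the
  right factor \<open>c\<close> moves into the last entry, and only a left factor \<open>x\<close>
  stays outside. Left multiplication by \<open>x\<close> commutes with bracketing by
  \<open>x\<close>.\<close>

lemma comm_span_commutator:
  assumes "comm_span x q f"
  shows "comm_span x (Suc q) ((f * x - x * f) * c)"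
  using assms
proof induction
  case (comm us)
  let ?e = "left_normed_commutator us"
  have ne: "us \<noteq> []" using comm by auto
  have "(?e * x - x * ?e) * c =
      left_normed_commutator (us @ [x * c]) + x * left_normed_commutator (us @ [- c])"
    by (simp add: left_normed_commutator_snoc[OF ne] algebra_simps)
  then show ?case
    using comm by (auto intro!: comm_span.intros)
next
  case (mult f)
  have "(x * f * x - x * (x * f)) * c = x * ((f * x - x * f) * c)"
    by (simp add: algebra_simps)
  then show ?case using mult.IH by (simp add: comm_span.mult)
next
  case (add f g)
  have "((f + g) * x - x * (f + g)) * c = (f * x - x * f) * c + (g * x - x * g) * c"
    by (simp add: algebra_simps)
  then show ?case using add.IH by (simp add: comm_span.add)
qed

lemma comm_span_in_ideal: "comm_span x q f \<Longrightarrow> f \<in> commutator_ideal (Suc q)"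
  by (induction rule: comm_span.induct)
     (auto intro: left_normed_commutator_in_ideal two_sided_idealD[OF two_sided_ideal_commutator_ideal])

section \<open>Partial derivatives and the Taylor projection\<close>

definition pd :: "'n \<Rightarrow> 'n free_algebra \<Rightarrow> 'n free_algebra" where
  "pd x = deriv_ext (\<lambda>i. if i = x then 1 else 0)"

text \<open>The infinitesimal form of the substitution \<open>x \<mapsto> x + t y\<close>. For
  \<open>y = x\<close> it is the Euler operator, which counts the letters \<open>x\<close>.\<close>

definition subst_der :: "'n \<Rightarrow> 'n \<Rightarrow> 'n free_algebra \<Rightarrow> 'n free_algebra" where
  "subst_der x y = deriv_ext (\<lambda>i. if i = x then var y else 0)"

interpretation pd: derivation "pd x" for x
  unfolding pd_def by (rule derivation_deriv_ext)

interpretation subst_der: derivation "subst_der x y" for x y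
  unfolding subst_der_def by (rule derivation_deriv_ext)

lemma pd_var [simp]: "pd x (var i) = (if i = x then 1 else 0)"
  by (simp add: pd_def)

lemma subst_der_var [simp]: "subst_der x y (var i) = (if i = x then var y else 0)"
  by (simp add: subst_der_def)

lemma pd_pow_add: "(pd x ^^ a) (f + g) = (pd x ^^ a) f + (pd x ^^ a) g"
  by (induction a) (auto simp: pd.add)

lemma pd_pow_const: "(pd x ^^ a) (const c * f) = const c * (pd x ^^ a) f"
  by (induction a) (auto simp: pd.const_mult)

lemma pd_pow_zero [simp]: "(pd x ^^ a) 0 = 0"
  by (induction a) auto

lemma pd_pow_mult_var_other: "i \<noteq> x \<Longrightarrow> (pd x ^^ a) (f * var i) = (pd x ^^ a) f * var i"
  by (induction a) (auto simp: pd.leibniz)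

text \<open>Only two Leibniz terms survive, since the second derivative of \<open>var x\<close> is
  0. For \<open>a = 0\<close> the term with the truncated exponent has factor 0.\<close>

lemma pd_pow_mult_var:
  "(pd x ^^ a) (f * var x) = (pd x ^^ a) f * var x + of_nat a * (pd x ^^ (a - 1)) f"
proof (induction a)
  case (Suc a)
  have "pd x (of_nat a * (pd x ^^ (a - 1)) f) = of_nat a * (pd x ^^ a) f"
    by (cases a) (simp_all add: pd.const_mult flip: const_of_nat del: of_nat_Suc)
  then show ?case
    by (simp add: Suc.IH pd.add pd.leibniz algebra_simps)
qed simp

lemma word_snoc: "word (l @ [i]) = word l * var i"
  by (simp add: var_def word_mult)

lemma pd_pow_word_eq_0: "length l < a \<Longrightarrow> (pd x ^^ a) (word l) = 0"
proof (induction l arbitrary: a rule: rev_induct)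
  case Nil
  then obtain b where "a = Suc b" by (cases a) auto
  then show ?case by (simp add: word_Nil funpow_swap1)
next
  case (snoc i l)
  then show ?case
    by (cases "i = x") (simp_all add: word_snoc pd_pow_mult_var pd_pow_mult_var_other)
qed

text \<open>For \<open>N\<close> large, this is the projection onto the kernel of \<open>\<partial>\<^sub>x\<close> along the left multiples of \<open>x\<close>.\<close>

definition taylor :: "'n \<Rightarrow> nat \<Rightarrow> 'n free_algebra \<Rightarrow> 'n free_algebra" where
  "taylor x N f = (\<Sum>a<N. const ((-1) ^ a / fact a) * (var x ^ a * (pd x ^^ a) f))"

lemma taylor_add: "taylor x N (f + g) = taylor x N f + taylor x N g"
  by (simp add: taylor_def pd_pow_add distrib_left sum.distrib)

lemma taylor_const: "taylor x N (const c * f) = const c * taylor x N f"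
proof -
  have comm: "const c1 * (u * (const c * v)) = const c * (const c1 * (u * v))" for c1 u v
    by (simp only: const_left_commute[of u] const_left_commute[of "const c1" c])
  show ?thesis
    by (simp only: taylor_def pd_pow_const sum_distrib_left comm)
qed

lemma taylor_mult_var_other: "i \<noteq> x \<Longrightarrow> taylor x N (f * var i) = taylor x N f * var i"
  by (simp add: taylor_def pd_pow_mult_var_other sum_distrib_right mult.assoc)

text \<open>The two terms of \<open>pd_pow_mult_var\<close> become right and left multiplication by
  \<open>x\<close>. After the index shift the second sum is one term short; the hypothesis makes the
  missing term vanish.\<close>

lemma taylor_mult_var:
  assumes "(pd x ^^ N) f = 0"
  shows "taylor x (Suc N) (f * var x) = taylor x (Suc N) f * var x - var x * taylor x (Suc N) f"
proof -
  let ?c = "\<lambda>a. (-1) ^ a / fact a :: complex"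
  have c: "?c (Suc a) * of_nat (Suc a) = - ?c a" for a
    by (simp add: field_simps del: of_nat_Suc)
  have "(\<Sum>a<Suc N. const (?c a) * (var x ^ a * (of_nat a * (pd x ^^ (a - 1)) f))) =
      (\<Sum>a<N. const (?c (Suc a)) * (var x ^ Suc a * (of_nat (Suc a) * (pd x ^^ a) f)))"
    by (subst sum.lessThan_Suc_shift) simp
  also have "\<dots> = (\<Sum>a<N. - (var x * (const (?c a) * (var x ^ a * (pd x ^^ a) f))))"
  proof (rule sum.cong)
    fix a
    have "const (?c (Suc a)) * (var x ^ Suc a * (of_nat (Suc a) * (pd x ^^ a) f)) =
        const (?c (Suc a) * of_nat (Suc a)) * (var x ^ Suc a * (pd x ^^ a) f)"
      by (simp only: const_of_nat[symmetric] const_left_commute[of "var x ^ _"] mult.assoc const_simps(4))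
    also have "\<dots> = - (var x * (const (?c a) * (var x ^ a * (pd x ^^ a) f)))"
      unfolding c const_left_commute[of "var x"] by (simp add: mult.assoc)
    finally show "const (?c (Suc a)) * (var x ^ Suc a * (of_nat (Suc a) * (pd x ^^ a) f)) =
        - (var x * (const (?c a) * (var x ^ a * (pd x ^^ a) f)))" .
  qed simp
  also have "\<dots> = - (var x * taylor x (Suc N) f)"
    by (simp add: taylor_def assms sum_negf sum_distrib_left)
  finally show ?thesis
    by (simp add: taylor_def pd_pow_mult_var sum.distrib distrib_left sum_distrib_right mult.assoc
        del: sum.lessThan_Suc)
qed

text \<open>Induction from the right end of the word: a final \<open>x\<close> becomes a bracket
  with \<open>x\<close> and raises the index by one; any other letter is absorbed into
  \<open>c\<close>, which therefore stays arbitrary.\<close>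

lemma comm_span_taylor:
  "length l < N \<Longrightarrow> comm_span (var x) (count_list l x) (taylor x N (word l) * c)"
proof (induction l arbitrary: c rule: rev_induct)
  case Nil
  \<comment> \<open>A commutator with a single entry is an arbitrary element.\<close>
  show ?case
    using comm_span.comm[of "[taylor x N (word []) * c]" 0] by simp
next
  case (snoc i l)
  show ?case
  proof (cases "i = x")
    case True
    obtain M where M: "N = Suc M" "length l < M" using snoc.prems by (cases N) auto
    have "comm_span (var x) (count_list l x) (taylor x N (word l))"
      using snoc.IH[of 1] snoc.prems by simp
    from comm_span_commutator[OF this, of c] show ?thesis
      using True taylor_mult_var[OF pd_pow_word_eq_0[OF M(2)], of x] by (simp add: word_snoc M)
  next
    case False
    then show ?thesis
      using snoc.IH[of "var i * c"] snoc.prems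
      by (simp add: word_snoc taylor_mult_var_other mult.assoc)
  qed
qed

lemma pd_pow_ideal:
  "f \<in> commutator_ideal (Suc p) \<Longrightarrow> (pd x ^^ a) f \<in> commutator_ideal (Suc p)"
  by (induction a) (auto intro: pd.commutator_ideal)

text \<open>The Taylor projection of \<open>f\<close> lies in the ideal by \<open>deg\<close>, and
  it differs from \<open>f\<close> only by a combination of left multiples of derivatives of
  \<open>pd x f\<close>.\<close>

lemma in_ideal_if_pd_in_ideal:
  assumes deg: "\<And>w. w \<in> Poly_Mapping.keys f \<Longrightarrow> p \<le> count_list (letters w) x"
    and pd: "pd x f \<in> commutator_ideal (Suc p)"
  shows "f \<in> commutator_ideal (Suc p)"
proof -
  let ?I = "commutator_ideal (Suc p)"
  note I = two_sided_idealD[OF two_sided_ideal_commutator_ideal[of "Suc p"]]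
  \<comment> \<open>\<open>N\<close> exceeds the length of every word of \<open>f\<close>; inserting
    0 keeps \<open>Max\<close> meaningful for \<open>f = 0\<close>.\<close>
  define N where "N = Suc (Max (insert 0 ((\<lambda>w. length (letters w)) ` Poly_Mapping.keys f)))"
  have N: "length (letters w) < N" if "w \<in> Poly_Mapping.keys f" for w
    using that by (auto simp: N_def less_Suc_eq_le intro!: Max_ge)
  have sum: "taylor x N (\<Sum>w\<in>S. g w) = (\<Sum>w\<in>S. taylor x N (g w))" for S and g :: "_ \<Rightarrow> 'a free_algebra"
    by (induction S rule: infinite_finite_induct) (auto simp: taylor_add, auto simp: taylor_def)
  have "taylor x N (word (letters w)) \<in> ?I" if "w \<in> Poly_Mapping.keys f" for w
    using comm_span_in_ideal[OF comm_span_taylor[OF N[OF that], of x 1]]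
      commutator_ideal_antimono[OF deg[OF that]] by auto
  then have t: "taylor x N f \<in> ?I"
    by (subst free_algebra_decomp[of f])
       (simp only: sum taylor_const, intro two_sided_ideal_sum[OF two_sided_ideal_commutator_ideal] I(3))
  obtain M where M: "N = Suc M" by (simp add: N_def)
  have eq: "taylor x N f = f + (\<Sum>a<M. const ((-1) ^ Suc a / fact (Suc a)) *
      (var x ^ Suc a * (pd x ^^ a) (pd x f)))"
    unfolding taylor_def M by (subst sum.lessThan_Suc_shift) (simp add: funpow_swap1 del: fact_Suc)
  have "(\<Sum>a<M. const ((-1) ^ Suc a / fact (Suc a)) *
      (var x ^ Suc a * (pd x ^^ a) (pd x f))) \<in> ?I"
    by (intro two_sided_ideal_sum[OF two_sided_ideal_commutator_ideal] I pd_pow_ideal pd)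
  from I(6)[OF t this] show ?thesis
    unfolding eq add_diff_cancel_right' .
qed

section \<open>Euler operators and commutation relations\<close>

lemma subst_der_self_word:
  "subst_der x x (word l) = const (of_nat (count_list l x)) * word l"
  by (induction l)
     (auto simp: word_Nil word_Cons subst_der.leibniz algebra_simps const_left_commute[of "var _"])

lemma lookup_const_mult: "Poly_Mapping.lookup (const c * f) w = c * Poly_Mapping.lookup f w"
proof (induction f rule: free_algebra_induct)
  case (word a l)
  show ?case by (simp add: const_mult_single lookup_single when_def)
qed (auto simp: distrib_left lookup_add)

lemma lookup_subst_der_self:
  "Poly_Mapping.lookup (subst_der x x f) w = of_nat (count_list (letters w) x) * Poly_Mapping.lookup f w"
proof (induction f rule: free_algebra_induct)
  case (word a l)
  show ?case
    by (auto simp: subst_der.const_mult subst_der_self_word lookup_const_mult lookup_single when_def)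
qed (auto simp: distrib_left lookup_add subst_der.add)

text \<open>Encodes homogeneity in \<open>x\<close> as an eigenvector equation, a form that is
  inherited along operators commuting with the Euler operator.\<close>

lemma count_list_of_eigenvector:
  assumes "subst_der x x f = const (of_nat k) * f" "w \<in> Poly_Mapping.keys f"
  shows "count_list (letters w) x = k"
proof -
  have "of_nat (count_list (letters w) x) * Poly_Mapping.lookup f w = of_nat k * Poly_Mapping.lookup f w"
    using lookup_subst_der_self[of x f w] unfolding assms(1) lookup_const_mult by (rule sym)
  then show ?thesis
    using assms(2) unfolding in_keys_iff by (metis mult_right_cancel of_nat_eq_iff)
qed

lemma bracket_pd_pd: "pd x (pd y f) = pd y (pd x f)"
  using derivation_eqI[OF derivation_bracket[OF pd.derivation_axioms[of x] pd.derivation_axioms[of y]]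
    derivation_zero, of f] by simp

text \<open>Both sides are derivations; the nonzero case comes from
  \<open>pd y (subst_der x y (var x)) = pd y (var y) = 1\<close>.\<close>

lemma bracket_pd_subst_der: "pd i (subst_der x y f) - subst_der x y (pd i f) = (if i = y then pd x f else 0)"
proof -
  note d = derivation_bracket[OF pd.derivation_axioms[of i] subst_der.derivation_axioms[of x y]]
  show ?thesis
    using derivation_eqI[OF d derivation_zero, of f]
      derivation_eqI[OF d pd.derivation_axioms[of x], of f] by (cases "i = y") simp_all
qed

lemma pd_pow_commute: "(pd x ^^ a) ((pd y ^^ b) f) = (pd y ^^ b) ((pd x ^^ a) f)"
proof -
  have 1: "pd x ((pd y ^^ b) f) = (pd y ^^ b) (pd x f)" for f b
    by (induction b) (auto simp: bracket_pd_pd[of x y])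
  show ?thesis by (induction a) (auto simp: 1)
qed

text \<open>\<open>subst_der x y\<close> commutes with \<open>pd x\<close>, and moving it past each
  of the \<open>Suc b\<close> factors \<open>pd y\<close> costs one \<open>pd x\<close>. Partial
  derivatives commute, so these terms coincide.\<close>

lemma subst_der_pd_pow:
  assumes "x \<noteq> y"
  shows "subst_der x y ((pd x ^^ a) ((pd y ^^ Suc b) f)) = (pd x ^^ a) ((pd y ^^ Suc b) (subst_der x y f)) -
    of_nat (Suc b) * (pd x ^^ Suc a) ((pd y ^^ b) f)"
proof -
  have 1: "subst_der x y (pd x f) = pd x (subst_der x y f)" for f
    using bracket_pd_subst_der[of x x y f] assms by simp
  have 2: "subst_der x y ((pd x ^^ a) f) = (pd x ^^ a) (subst_der x y f)" for f
    by (induction a) (auto simp: 1)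
  have 3: "subst_der x y (pd y f) = pd y (subst_der x y f) - pd x f" for f
    using bracket_pd_subst_der[of y x y f] by (simp add: algebra_simps)
  have 4: "subst_der x y ((pd y ^^ Suc b) f) =
      (pd y ^^ Suc b) (subst_der x y f) - const (of_nat (Suc b)) * pd x ((pd y ^^ b) f)"
  proof (induction b)
    case 0
    show ?case by (simp add: 3)
  next
    case (Suc b)
    have "subst_der x y ((pd y ^^ Suc (Suc b)) f) =
        pd y (subst_der x y ((pd y ^^ Suc b) f)) - pd x ((pd y ^^ Suc b) f)"
      by (simp add: 3)
    also have "pd y (subst_der x y ((pd y ^^ Suc b) f)) =
        (pd y ^^ Suc (Suc b)) (subst_der x y f) - const (of_nat (Suc b)) * pd x ((pd y ^^ Suc b) f)"
      by (simp only: Suc.IH pd.diff pd.const_mult bracket_pd_pd[of y x])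
         (simp only: funpow.simps o_apply)
    finally show ?case
      by (simp add: of_nat_Suc[of "Suc b"] algebra_simps del: of_nat_Suc funpow.simps)
  qed
  have 5: "(pd x ^^ a) (f - g) = (pd x ^^ a) f - (pd x ^^ a) g" for f g
    by (induction a) (auto simp: pd.diff)
  show ?thesis
    unfolding 2 4 5 pd_pow_const by (simp add: funpow_swap1 const_of_nat del: of_nat_Suc const_simps)
qed

lemma pd_pow_eq_0: "\<exists>N. \<forall>a>N. (pd x ^^ a) f = 0"
proof (induction f rule: free_algebra_induct)
  case (add f g)
  then obtain M N where "\<forall>a>M. (pd x ^^ a) f = 0" "\<forall>a>N. (pd x ^^ a) g = 0" by auto
  then have "\<forall>a>max M N. (pd x ^^ a) (f + g) = 0" by (simp add: pd_pow_add)
  then show ?case ..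
next
  case (word c l)
  show ?case
    by (rule exI[of _ "length l"]) (simp add: pd_pow_const pd_pow_word_eq_0)
qed simp

lemma in_ideal_if_subst_der_in_ideal:
  assumes "x \<noteq> y" and eig: "subst_der x x f = const (of_nat k) * f" and "p \<le> k"
    and F: "subst_der x y f \<in> commutator_ideal (Suc p)"
  shows "f \<in> commutator_ideal (Suc p)"
proof -
  let ?I = "commutator_ideal (Suc p)"
  note I = two_sided_idealD[OF two_sided_ideal_commutator_ideal[of "Suc p"]]
  \<comment> \<open>Descending induction on the total order \<open>N\<close>: \<open>C\<close> holds
    for a large order by nilpotency, and \<open>C 0\<close> gives the claim.\<close>
  define C where "C N \<longleftrightarrow> (\<forall>a b. a + b = N \<longrightarrow> (pd x ^^ a) ((pd y ^^ b) f) \<in> ?I)" for N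
  obtain M1 M2 where M: "\<forall>a>M1. (pd x ^^ a) f = 0" "\<forall>a>M2. (pd y ^^ a) f = 0"
    using pd_pow_eq_0 by metis
  have top: "C (M1 + M2 + 1)"
    unfolding C_def
  proof (intro allI impI)
    fix a b assume "a + b = M1 + M2 + 1"
    then consider "a > M1" | "b > M2" by linarith
    then show "(pd x ^^ a) ((pd y ^^ b) f) \<in> ?I"
      using M by cases (auto simp: pd_pow_commute[of a x] I(1))
  qed
  have step: "C N" if "C (Suc N)" for N
  proof -
    have "(pd x ^^ a) ((pd y ^^ b) f) \<in> ?I" if "a + b = N" for a b
      using that
    proof (induction a arbitrary: b)
      \<comment> \<open>Derivatives in \<open>y\<close> keep the degree \<open>k\<close> in
        \<open>x\<close>, and a further derivative in \<open>x\<close> has order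
        \<open>N + 1\<close>, so \<open>in_ideal_if_pd_in_ideal\<close> applies to
        \<open>(pd y ^^ b) f\<close>.\<close>
      case 0
      have comm: "subst_der x x (pd y g) = pd y (subst_der x x g)" for g
        using bracket_pd_subst_der[of y x x g] assms(1) by simp
      have "subst_der x x ((pd y ^^ b) f) = (pd y ^^ b) (subst_der x x f)"
        by (induction b) (auto simp: comm)
      then have "subst_der x x ((pd y ^^ b) f) = const (of_nat k) * (pd y ^^ b) f"
        by (simp add: eig pd_pow_const)
      moreover have "pd x ((pd y ^^ b) f) \<in> ?I"
        using \<open>C (Suc N)\<close>[unfolded C_def, rule_format, of 1 b] 0 by simp
      ultimately have "(pd y ^^ b) f \<in> ?I"
        using in_ideal_if_pd_in_ideal[of "(pd y ^^ b) f" p x]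
          count_list_of_eigenvector[of x "(pd y ^^ b) f" k] \<open>p \<le> k\<close> by simp
      then show ?case by simp
    next
      \<comment> \<open>\<open>subst_der x y\<close> is applied to the derivative with one
        \<open>pd x\<close> traded for a \<open>pd y\<close>. The term containing
        \<open>subst_der x y f\<close> lies in the ideal by \<open>F\<close>, which isolates a
        multiple of \<open>?g\<close>.\<close>
      case (Suc a)
      let ?g = "(pd x ^^ Suc a) ((pd y ^^ b) f)"
      have "(pd x ^^ a) ((pd y ^^ Suc b) f) \<in> ?I"
        using Suc.IH[of "Suc b"] Suc.prems by simp
      then have 1: "subst_der x y ((pd x ^^ a) ((pd y ^^ Suc b) f)) \<in> ?I"
        by (rule subst_der.commutator_ideal)
      have 2: "(pd x ^^ a) ((pd y ^^ Suc b) (subst_der x y f)) \<in> ?I"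
        by (intro pd_pow_ideal F)
      have "const (of_nat (Suc b)) * ?g \<in> ?I"
        using I(6)[OF 2 1] unfolding subst_der_pd_pow[OF assms(1)] const_of_nat diff_diff_eq2
          add_diff_cancel_left' .
      then show ?case
        by (rule two_sided_ideal_const_cancel[OF two_sided_ideal_commutator_ideal]) (simp del: of_nat_Suc)
    qed
    then show ?thesis by (simp add: C_def)
  qed
  have "C 0"
    using inc_induct[of 0 "M1 + M2 + 1" C] top step by auto
  then show ?thesis by (simp add: C_def)
qed

section \<open>Multihomogeneous components\<close>

lemma derivation_scale:
  assumes "derivation d"
  shows "derivation (\<lambda>f. const c * d f)"
proof -
  interpret derivation d by fact
  show ?thesis
  proof
    fix a f show "const c * d (const a * f) = const a * (const c * d f)"
      unfolding const_mult by (rule const_left_commute)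
  qed (simp_all add: add leibniz distrib_left const_left_commute mult.assoc)
qed

text \<open>\<open>subst_der x y\<close> replaces one letter \<open>x\<close> by \<open>y\<close>,
  so it shifts the multidegree by 1 at \<open>y\<close> and by -1 at \<open>x\<close>.\<close>

lemma bracket_subst_der_subst_der:
  "subst_der i i (subst_der x y f) =
    subst_der x y (subst_der i i f) + const (of_bool (i = y) - of_bool (i = x)) * subst_der x y f"
proof -
  have "subst_der i i (subst_der x y f) - subst_der x y (subst_der i i f) =
      const (of_bool (i = y) - of_bool (i = x)) * subst_der x y f"
    by (rule derivation_eqI[OF derivation_bracket[OF subst_der.derivation_axioms subst_der.derivation_axioms]
          derivation_scale[OF subst_der.derivation_axioms]]) auto
  then show ?thesis by (simp add: algebra_simps)
qed

text \<open>The ideal is stable under the Euler operators. Subtracting the eigenvalue of one summand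
  kills it and rescales the others, so summands are eliminated one at a time.\<close>

lemma eigencomponent_in_ideal:
  fixes f :: "'b \<Rightarrow> 'n free_algebra" and ev :: "'b \<Rightarrow> 'n \<Rightarrow> complex"
  assumes "finite S" "a \<notin> S"
    and "\<And>b i. b \<in> insert a S \<Longrightarrow> subst_der i i (f b) = const (ev b i) * f b"
    and "inj_on ev (insert a S)"
    and "(\<Sum>b\<in>insert a S. f b) \<in> commutator_ideal (Suc p)"
  shows "f a \<in> commutator_ideal (Suc p)"
  using assms
proof (induction S arbitrary: f rule: finite_induct)
  case (insert c S)
  let ?I = "commutator_ideal (Suc p)"
  note I = two_sided_idealD[OF two_sided_ideal_commutator_ideal[of "Suc p"]]
  have "ev a \<noteq> ev c" using insert.prems insert.hyps by (auto simp: inj_on_def)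
  \<comment> \<open>This choice of variable makes the scalar in \<open>g a\<close> nonzero.\<close>
  then obtain i where i: "ev a i \<noteq> ev c i" by auto
  define g where "g b = const (ev b i - ev c i) * f b" for b
  let ?s = "\<Sum>b\<in>insert a (insert c S). f b"
  have "subst_der i i ?s - const (ev c i) * ?s \<in> ?I"
    by (intro I subst_der.commutator_ideal insert.prems)
  also have "subst_der i i ?s - const (ev c i) * ?s = (\<Sum>b\<in>insert a (insert c S). g b)"
    unfolding subst_der.sum sum_distrib_left sum_subtractf[symmetric]
    by (rule sum.cong) (use insert.prems(2) in \<open>auto simp: g_def left_diff_distrib\<close>)
  also have "\<dots> = (\<Sum>b\<in>insert a S. g b)"
    by (rule sum.mono_neutral_right) (use insert.hyps in \<open>auto simp: g_def\<close>)
  finally have "g a \<in> ?I"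
  proof (intro insert.IH[of g])
    show "subst_der j j (g b) = const (ev b j) * g b" if "b \<in> insert a S" for b j
    proof -
      have e: "subst_der j j (f b) = const (ev b j) * f b"
        using insert.prems(2) that by blast
      show ?thesis
        unfolding g_def subst_der.const_mult e by (rule const_left_commute)
    qed
  qed (use insert.prems in \<open>auto simp: inj_on_def\<close>)
  then show ?case
    unfolding g_def by (rule two_sided_ideal_const_cancel[OF two_sided_ideal_commutator_ideal]) (use i in simp)
qed simp

definition word_filter :: "('n list \<Rightarrow> bool) \<Rightarrow> 'n free_algebra \<Rightarrow> 'n free_algebra" where
  "word_filter P = word_lift (\<lambda>l. if P l then word l else 0)"

lemma lookup_word_filter:
  "Poly_Mapping.lookup (word_filter P f) w = (if P (letters w) then Poly_Mapping.lookup f w else 0)"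
proof (induction f rule: free_algebra_induct)
  case (word c l)
  show ?case
    unfolding word_filter_def word_lift_const_word lookup_const_mult
    by (auto simp: lookup_single when_def)
qed (auto simp: word_filter_def word_lift_add lookup_add, simp add: word_lift_def)

text \<open>The function \<open>count_list l\<close> is the multidegree of the word
  \<open>l\<close>, so this filter cuts out a multihomogeneous component.\<close>

lemma subst_der_self_component:
  "subst_der i i (word_filter (\<lambda>l. count_list l = \<mu>) f) =
    const (of_nat (\<mu> i)) * word_filter (\<lambda>l. count_list l = \<mu>) f"
  by (rule poly_mapping_eqI) (auto simp: lookup_subst_der_self lookup_word_filter lookup_const_mult)

lemma sum_components:
  assumes "finite M" "\<And>w. w \<in> Poly_Mapping.keys f \<Longrightarrow> count_list (letters w) \<in> M"
  shows "(\<Sum>\<mu>\<in>M. word_filter (\<lambda>l. count_list l = \<mu>) f) = f"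
proof (rule poly_mapping_eqI)
  fix w
  have "(\<Sum>\<mu>\<in>M. Poly_Mapping.lookup (word_filter (\<lambda>l. count_list l = \<mu>) f) w) =
      (if count_list (letters w) \<in> M then Poly_Mapping.lookup f w else 0)"
    using assms(1) by (simp add: lookup_word_filter)
  then show "Poly_Mapping.lookup (\<Sum>\<mu>\<in>M. word_filter (\<lambda>l. count_list l = \<mu>) f) w =
      Poly_Mapping.lookup f w"
    using assms(2)[of w] by (auto simp: lookup_sum in_keys_iff)
qed

text \<open>All multidegrees are shifted by the same vector, so the images of different components
  are still separated by their eigenvalues.\<close>

lemma subst_der_component_in_ideal:
  assumes "subst_der x y f \<in> commutator_ideal (Suc p)"
  shows "subst_der x y (word_filter (\<lambda>l. count_list l = \<mu>) f) \<in> commutator_ideal (Suc p)"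
proof -
  let ?c = "\<lambda>\<mu>. word_filter (\<lambda>l. count_list l = \<mu>) f"
  define M where "M = (\<lambda>w. count_list (letters w)) ` Poly_Mapping.keys f"
  define ev where "ev \<nu> i = of_nat (\<nu> i) + (of_bool (i = y) - of_bool (i = x) :: complex)" for \<nu> i
  \<comment> \<open>The index set \<open>insert \<mu> (M - {\<mu>})\<close> also covers a
    multidegree that does not occur in \<open>f\<close>.\<close>
  show ?thesis
  proof (rule eigencomponent_in_ideal[where S = "M - {\<mu>}" and f = "\<lambda>\<nu>. subst_der x y (?c \<nu>)" and ev = ev])
    show "subst_der i i (subst_der x y (?c \<nu>)) = const (ev \<nu> i) * subst_der x y (?c \<nu>)" for \<nu> i
      unfolding bracket_subst_der_subst_der subst_der_self_component subst_der.const_mult ev_def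
      by (simp only: const_simps(3) distrib_right)
    show "inj_on ev (insert \<mu> (M - {\<mu>}))"
      by (auto simp: inj_on_def ev_def fun_eq_iff)
    have "(\<Sum>\<nu>\<in>insert \<mu> (M - {\<mu>}). ?c \<nu>) = f"
      by (rule sum_components) (auto simp: M_def)
    then show "(\<Sum>\<nu>\<in>insert \<mu> (M - {\<mu>}). subst_der x y (?c \<nu>)) \<in> commutator_ideal (Suc p)"
      unfolding subst_der.sum[symmetric] using assms by simp
  qed (auto simp: M_def)
qed

lemma diff_truncation_in_ideal:
  fixes f :: "'n::finite free_algebra"
  assumes "\<And>x. \<exists>y. y \<noteq> x \<and> subst_der x y f \<in> commutator_ideal (Suc p)"
  shows "f - word_filter (\<lambda>l. length l \<le> CARD('n) * (p - 1)) f \<in> commutator_ideal (Suc p)"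
proof -
  let ?N = "CARD('n) * (p - 1)" and ?c = "\<lambda>\<mu> f. word_filter (\<lambda>l. count_list l = \<mu>) f"
  define h where "h = f - word_filter (\<lambda>l. length l \<le> ?N) f"
  define M where "M = (\<lambda>w. count_list (letters w)) ` Poly_Mapping.keys h"
  have h: "Poly_Mapping.lookup h w = (if length (letters w) > ?N then Poly_Mapping.lookup f w else 0)" for w
    by (simp add: h_def lookup_minus lookup_word_filter)
  have "?c \<mu> h \<in> commutator_ideal (Suc p)" if "\<mu> \<in> M" for \<mu>
  proof -
    from that obtain w where w: "w \<in> Poly_Mapping.keys h" "\<mu> = count_list (letters w)"
      by (auto simp: M_def)
    then have "(\<Sum>i\<in>UNIV. \<mu> i) > ?N"
      using sum_count_set[of "letters w" UNIV] by (auto simp: h in_keys_iff split: if_splits)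
    \<comment> \<open>Pigeonhole: n exponents with sum above n (p - 1) cannot all be at most p -
      1.\<close>
    then have "\<not> (\<forall>i. \<mu> i \<le> p - 1)"
      using sum_bounded_above[of UNIV \<mu> "p - 1"] by auto
    then obtain x where "p - 1 < \<mu> x" by (auto simp: not_le)
    then have "p \<le> \<mu> x" by simp
    obtain y where "y \<noteq> x" and y: "subst_der x y f \<in> commutator_ideal (Suc p)"
      using assms by blast
    have "?c \<mu> f \<in> commutator_ideal (Suc p)"
      by (rule in_ideal_if_subst_der_in_ideal[OF \<open>y \<noteq> x\<close>[symmetric] subst_der_self_component[of x \<mu> f] \<open>p \<le> \<mu> x\<close>
            subst_der_component_in_ideal[OF y]])
    \<comment> \<open>All words of multidegree \<mu> have the same length, which exceeds the bound,
      so truncation leaves this component alone.\<close>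
    also have "?c \<mu> f = ?c \<mu> h"
    proof (rule poly_mapping_eqI)
      fix v
      have "length (letters v) > ?N" if "count_list (letters v) = \<mu>"
        using \<open>(\<Sum>i\<in>UNIV. \<mu> i) > ?N\<close> sum_count_set[of "letters v" UNIV] that by simp
      then show "Poly_Mapping.lookup (?c \<mu> f) v = Poly_Mapping.lookup (?c \<mu> h) v"
        by (simp add: lookup_word_filter h)
    qed
    finally show ?thesis .
  qed
  then have "(\<Sum>\<mu>\<in>M. ?c \<mu> h) \<in> commutator_ideal (Suc p)"
    by (rule two_sided_ideal_sum[OF two_sided_ideal_commutator_ideal])
  also have "(\<Sum>\<mu>\<in>M. ?c \<mu> h) = h"
    by (rule sum_components) (auto simp: M_def)
  finally show ?thesis unfolding h_def .
qed

section \<open>The group action and transvections\<close>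

lemma act_eq_word_lift:
  "act g = word_lift (\<lambda>l. prod_list (map (\<lambda>j. linear_form (g *v axis j 1)) l))"
  by (rule ext) (simp add: act_def word_lift_def)

lemma act_add: "act g (f + h) = act g f + act g h"
  by (simp add: act_eq_word_lift word_lift_add)

lemma act_const_mult: "act g (const c * f) = const c * act g f"
  by (simp add: act_eq_word_lift word_lift_const)

lemma act_zero [simp]: "act g 0 = 0"
  using act_add[of g 0 0] by simp

lemma act_diff: "act g (f - h) = act g f - act g h"
  using act_add[of g "f - h" h] by (simp add: algebra_simps)

lemma act_sum: "act g (\<Sum>i\<in>S. f i) = (\<Sum>i\<in>S. act g (f i))"
  by (induction S rule: infinite_finite_induct) (auto simp: act_add)

lemma act_word: "act g (word l) = prod_list (map (\<lambda>j. linear_form (g *v axis j 1)) l)"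
  by (simp add: act_eq_word_lift)

lemma act_var: "act g (var j) = linear_form (g *v axis j 1)"
  unfolding var_def act_word by simp

text \<open>Substituting linear forms for letters turns concatenation into a product. Singular
  matrices are included; \<open>one_notin_commutator_ideal\<close> uses the zero matrix.\<close>

lemma act_mult: "act g (f * h) = act g f * act g h"
proof -
  have 1: "act g (word u * h) = act g (word u) * act g h" for u
  proof (induction h rule: free_algebra_induct)
    case (word c l)
    have "act g (word u * (const c * word l)) = const c * act g (word (u @ l))"
      by (simp only: const_left_commute act_const_mult word_mult)
    also have "\<dots> = const c * (act g (word u) * act g (word l))"
      by (simp only: act_word map_append prod_list.append)
    also have "\<dots> = act g (word u) * act g (const c * word l)"
      by (simp only: act_const_mult const_left_commute[of "act g _"])
    finally show ?case .
  qed (simp_all add: act_add distrib_left)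
  show ?thesis
  proof (induction f rule: free_algebra_induct)
    case (word c l)
    show ?case by (simp only: mult.assoc act_const_mult 1)
  qed (simp_all add: act_add distrib_right)
qed

lemma act_one [simp]: "act g 1 = 1"
  using act_word[of g "[]"] by (simp add: word_Nil)

lemma act_left_normed_commutator:
  "act g (left_normed_commutator us) = left_normed_commutator (map (act g) us)"
proof (induction us rule: rev_induct)
  case (snoc c us)
  then show ?case
    by (cases "us = []") (simp_all add: left_normed_commutator_snoc act_diff act_mult)
qed simp

text \<open>The preimage of the ideal is an ideal, and commutators go to commutators of the same
  length.\<close>

lemma act_commutator_ideal:
  assumes "f \<in> commutator_ideal m"
  shows "act g f \<in> commutator_ideal m"
proof -
  note I = two_sided_idealD[OF two_sided_ideal_commutator_ideal[of m]]
  have "commutator_ideal m \<subseteq> {f. act g f \<in> commutator_ideal m}"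
    by (rule commutator_ideal_minimal)
       (auto simp: two_sided_ideal_def act_add act_mult act_left_normed_commutator
         intro: I left_normed_commutator_in_ideal)
  with assms show ?thesis by auto
qed

lemma matrix_vector_mult_axis_nth: "(g *v axis i 1) $ k = (g $ k $ i :: 'a::semiring_1)"
  by (simp add: matrix_vector_mult_def axis_def if_distrib cong: if_cong)

lemma act_linear_form: "act g (linear_form v) = linear_form (g *v v)"
proof -
  have "act g (linear_form v) = (\<Sum>i\<in>UNIV. const (v $ i) * (\<Sum>k\<in>UNIV. const (g $ k $ i) * var k))"
    by (simp add: linear_form_def[of v] act_sum act_const_mult act_var)
       (simp add: linear_form_def matrix_vector_mult_axis_nth)
  also have "\<dots> = (\<Sum>k\<in>UNIV. \<Sum>i\<in>UNIV. const (v $ i) * (const (g $ k $ i) * var k))"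
    unfolding sum_distrib_left by (rule sum.swap)
  also have "\<dots> = (\<Sum>k\<in>UNIV. const ((g *v v) $ k) * var k)"
  proof (rule sum.cong)
    fix k
    have cs: "const (\<Sum>i\<in>S. c i) = (\<Sum>i\<in>S. const (c i))" for S and c :: "'a \<Rightarrow> complex"
      by (induction S rule: infinite_finite_induct) auto
    show "(\<Sum>i\<in>UNIV. const (v $ i) * (const (g $ k $ i) * var k)) = const ((g *v v) $ k) * var k"
      unfolding matrix_vector_mult_def vec_lambda_beta cs sum_distrib_right
      by (simp add: mult.assoc[symmetric] mult.commute[of "v $ _"] flip: const_simps(4))
  qed simp
  finally show ?thesis by (simp add: linear_form_def)
qed

lemma act_act: "act g (act h f) = act (g ** h) f"
proof (induction f rule: free_algebra_induct)
  case (word c l)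
  have "act g (act h (word l)) = act (g ** h) (word l)"
    by (induction l)
       (simp_all add: word_Nil word_Cons act_mult act_var act_linear_form matrix_vector_mul_assoc)
  then show ?case by (simp add: act_const_mult)
qed (simp_all add: act_add)

lemma linear_form_axis: "linear_form (axis j 1) = var j"
proof -
  have "linear_form (axis j 1) = (\<Sum>i\<in>UNIV. if i = j then var i else 0)"
    unfolding linear_form_def by (rule sum.cong) (auto simp: axis_def)
  then show ?thesis by simp
qed

lemma act_mat_1 [simp]: "act (mat 1) f = f"
proof (induction f rule: free_algebra_induct)
  case (word c l)
  have "act (mat 1) (word l) = word l"
    by (induction l) (simp_all add: word_Nil word_Cons act_mult act_var linear_form_axis)
  then show ?case by (simp add: act_const_mult)
qed (simp_all add: act_add)

lemma homogeneous_add: "f \<in> homogeneous d \<Longrightarrow> g \<in> homogeneous d \<Longrightarrow> f + g \<in> homogeneous d"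
  using keys_add[of f g] by (auto simp: homogeneous_def)

lemma homogeneous_const_mult: "f \<in> homogeneous d \<Longrightarrow> const c * f \<in> homogeneous d"
  by (auto simp: homogeneous_def in_keys_iff lookup_const_mult)

lemma homogeneous_sum: "(\<And>i. i \<in> S \<Longrightarrow> f i \<in> homogeneous d) \<Longrightarrow> (\<Sum>i\<in>S. f i) \<in> homogeneous d"
  by (induction S rule: infinite_finite_induct) (auto simp: homogeneous_add, auto simp: homogeneous_def)

lemma homogeneous_mult: "f \<in> homogeneous d \<Longrightarrow> g \<in> homogeneous e \<Longrightarrow> f * g \<in> homogeneous (d + e)"
  using keys_mult[of f g] by (fastforce simp: homogeneous_def plus_free_monoid_def)

lemma homogeneous_act_word: "act g (word l) \<in> homogeneous (length l)"
proof (induction l)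
  case Nil
  show ?case by (simp add: word_Nil homogeneous_def zero_free_monoid_def)
next
  case (Cons i l)
  have "act g (var i) \<in> homogeneous 1"
    unfolding act_var linear_form_def
    by (intro homogeneous_sum homogeneous_const_mult) (simp add: homogeneous_def var_def)
  from homogeneous_mult[OF this Cons.IH] show ?case by (simp add: word_Cons act_mult)
qed

lemma homogeneous_act:
  assumes "f \<in> homogeneous d"
  shows "act g f \<in> homogeneous d"
proof -
  have "act g (word (letters w)) \<in> homogeneous d" if "w \<in> Poly_Mapping.keys f" for w
    using homogeneous_act_word[of g "letters w"] assms that by (simp add: homogeneous_def)
  then show ?thesis
    by (subst free_algebra_decomp[of f])
       (simp only: act_sum act_const_mult, intro homogeneous_sum homogeneous_const_mult)
qed

definition up_to_degree :: "nat \<Rightarrow> 'n free_algebra set" where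
  "up_to_degree N = {f. \<forall>w\<in>Poly_Mapping.keys f. length (letters w) \<le> N}"

lemma up_to_degree_sum: "(\<And>i. i \<in> S \<Longrightarrow> f i \<in> up_to_degree N) \<Longrightarrow> (\<Sum>i\<in>S. f i) \<in> up_to_degree N"
proof (induction S rule: infinite_finite_induct)
  case (insert i S)
  then show ?case using keys_add[of "f i" "sum f S"] by (auto simp: up_to_degree_def)
qed (auto simp: up_to_degree_def)

lemma act_up_to_degree:
  assumes "f \<in> up_to_degree N"
  shows "act g f \<in> up_to_degree N"
proof -
  have "const c * act g (word (letters w)) \<in> up_to_degree N" if "w \<in> Poly_Mapping.keys f" for w c
    using homogeneous_const_mult[OF homogeneous_act_word[of g "letters w"], of c] assms that
    by (auto simp: homogeneous_def up_to_degree_def)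
  then show ?thesis
    by (subst free_algebra_decomp[of f]) (simp only: act_sum act_const_mult, rule up_to_degree_sum)
qed

text \<open>The matrix \<open>1 + t E\<close> with \<open>E\<close> the matrix unit in row
  \<open>y\<close> and column \<open>x\<close>. Columns are images of variables, so \<open>x\<close>
  goes to \<open>x + t y\<close>.\<close>

definition transvection :: "'n \<Rightarrow> 'n \<Rightarrow> complex \<Rightarrow> complex^'n^'n::finite" where
  "transvection x y t = (\<chi> k i. of_bool (k = i) + (if k = y \<and> i = x then t else 0))"

lemma transvection_mult_vec: "transvection x y t *v v = v + (t * v $ x) *s axis y 1"
proof -
  have "(transvection x y t *v v) $ k = (\<Sum>i\<in>UNIV. (if i = k then v $ i else 0) +
      (if i = x then (if k = y then t * v $ i else 0) else 0))" for k
    unfolding transvection_def matrix_vector_mult_def vec_lambda_beta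
    by (rule sum.cong) (auto simp: distrib_right)
  then show ?thesis
    by (auto simp: vec_eq_iff axis_def sum.distrib)
qed

lemma linear_form_add: "linear_form (u + v) = linear_form u + linear_form v"
  by (simp add: linear_form_def sum.distrib distrib_right)

lemma linear_form_scale: "linear_form (c *s v) = const c * linear_form v"
  by (simp add: linear_form_def sum_distrib_left mult.assoc)

lemma act_transvection_var:
  "act (transvection x y t) (var j) = var j + (if j = x then const t * var y else 0)"
  by (auto simp: act_var transvection_mult_vec linear_form_add linear_form_scale linear_form_axis)
     (auto simp: axis_def linear_form_def)

text \<open>A word is sent to a product of factors affine in \<open>t\<close>, hence to a polynomial
  in \<open>t\<close> whose linear coefficient follows the Leibniz rule. Admitting every
  \<open>n \<ge> m\<close> lets two expansions be added at a common length.\<close>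

lemma act_transvection_expansion:
  "\<exists>m h. h 0 = f \<and> h (Suc 0) = subst_der x y f \<and>
    (\<forall>t. \<forall>n\<ge>m. act (transvection x y t) f = (\<Sum>k<n. const (t ^ k) * h k))"
proof (induction f rule: free_algebra_induct)
  case zero
  show ?case by (intro exI[of _ 0] exI[of _ "\<lambda>_. 0"]) simp
next
  case (add f g)
  obtain m1 h1 m2 h2 where h: "h1 0 = f" "h1 (Suc 0) = subst_der x y f"
    "\<And>t n. n \<ge> m1 \<Longrightarrow> act (transvection x y t) f = (\<Sum>k<n. const (t ^ k) * h1 k)"
    "h2 0 = g" "h2 (Suc 0) = subst_der x y g"
    "\<And>t n. n \<ge> m2 \<Longrightarrow> act (transvection x y t) g = (\<Sum>k<n. const (t ^ k) * h2 k)"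
    using add.IH by blast
  show ?case
    by (intro exI[of _ "max m1 m2"] exI[of _ "\<lambda>k. h1 k + h2 k"])
       (auto simp: h subst_der.add act_add distrib_left sum.distrib)
next
  case (word c l)
  have "\<exists>m h. h 0 = word l \<and> h (Suc 0) = subst_der x y (word l) \<and>
    (\<forall>t. \<forall>n\<ge>m. act (transvection x y t) (word l) = (\<Sum>k<n. const (t ^ k) * h k))"
  proof (induction l)
    case Nil
    show ?case
    proof (intro exI[of _ "1::nat"] exI[of _ "\<lambda>k::nat. of_bool (k = 0)"] conjI allI impI)
      fix t :: complex and n :: nat assume "1 \<le> n"
      then have "(\<Sum>k<n. const (t ^ k) * of_bool (k = 0)) = (1 :: 'a free_algebra)"
        by (cases n) (simp_all add: sum.lessThan_Suc_shift)
      then show "act (transvection x y t) (word []) = (\<Sum>k<n. const (t ^ k) * of_bool (k = 0))"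
        by (simp add: word_Nil)
    qed (simp_all add: word_Nil)
  next
    case (Cons j l)
    then obtain m h where h: "h 0 = word l" "h (Suc 0) = subst_der x y (word l)"
      "\<And>t n. n \<ge> m \<Longrightarrow> act (transvection x y t) (word l) = (\<Sum>k<n. const (t ^ k) * h k)"
      by blast
    define d where "d = (if j = x then var y else 0 :: 'a free_algebra)"
    \<comment> \<open>The coefficients of the product of \<open>var j + t d\<close> with the
      expansion for \<open>l\<close>.\<close>
    define h' where "h' k = var j * h k + (case k of 0 \<Rightarrow> 0 | Suc i \<Rightarrow> d * h i)" for k
    show ?case
    proof (intro exI[of _ "Suc m"] exI[of _ h'] conjI allI impI)
      fix t n assume "Suc m \<le> n"
      then obtain n' where n: "n = Suc n'" "m \<le> n'" by (cases n) auto
      have shift: "(\<Sum>k<Suc n'. const (t ^ k) * (case k of 0 \<Rightarrow> 0 | Suc i \<Rightarrow> d * h i)) =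
          (\<Sum>k<n'. const (t ^ Suc k) * (d * h k))"
        by (subst sum.lessThan_Suc_shift) simp
      have "(\<Sum>k<n. const (t ^ k) * h' k) =
          var j * (\<Sum>k<n. const (t ^ k) * h k) + (\<Sum>k<n'. const (t ^ Suc k) * (d * h k))"
        unfolding n h'_def distrib_left sum.distrib sum_distrib_left const_left_commute[of "var j"]
        unfolding shift ..
      also have "(\<Sum>k<n'. const (t ^ Suc k) * (d * h k)) = const t * d * (\<Sum>k<n'. const (t ^ k) * h k)"
        unfolding sum_distrib_left
        by (simp only: power_Suc const_simps(4) mult.assoc const_left_commute[of d])
      finally have "(\<Sum>k<n. const (t ^ k) * h' k) =
          (var j + const t * d) * act (transvection x y t) (word l)"
        using h(3)[of n' t] h(3)[of n t] n by (simp only: distrib_right le_SucI)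
      then show "act (transvection x y t) (word (j # l)) = (\<Sum>k<n. const (t ^ k) * h' k)"
        by (auto simp: word_Cons act_mult act_transvection_var d_def)
    qed (simp_all add: h'_def h word_Cons subst_der.leibniz d_def)
  qed
  then obtain m h where h: "h 0 = word l" "h (Suc 0) = subst_der x y (word l)"
    "\<And>t n. n \<ge> m \<Longrightarrow> act (transvection x y t) (word l) = (\<Sum>k<n. const (t ^ k) * h k)"
    by blast
  have "act (transvection x y t) (const c * word l) = (\<Sum>k<n. const (t ^ k) * (const c * h k))"
    if "n \<ge> m" for t n
    unfolding act_const_mult h(3)[OF that] sum_distrib_left by (rule sum.cong[OF refl const_left_commute])
  then show ?case
    by (intro exI[of _ m] exI[of _ "\<lambda>k. const c * h k"])
       (simp add: h subst_der.const_mult)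
qed

text \<open>Vandermonde elimination with top index \<open>m\<close>: replacing \<open>t\<close> by
  \<open>2 t\<close> and subtracting \<open>2 ^ m\<close> times the original sum kills the top
  coefficient and multiplies \<open>h k\<close> by \<open>2 ^ k - 2 ^ m\<close>, which is nonzero
  for \<open>k < m\<close>.\<close>

lemma poly_coeff_in_ideal:
  assumes "two_sided_ideal I" "\<And>t. (\<Sum>k<m. const (t ^ k) * h k) \<in> I" "k < m"
  shows "h k \<in> I"
  using assms(2,3)
proof (induction m arbitrary: h k)
  case (Suc m)
  note I = two_sided_idealD[OF assms(1)]
  have *: "h k \<in> I" if "k < m" for k
  proof -
    define g where "g k = const (2 ^ k - 2 ^ m) * h k" for k
    have "(\<Sum>k<m. const (t ^ k) * g k) \<in> I" for t
    proof -
      have "(\<Sum>k<Suc m. const ((2 * t) ^ k) * h k) - const (2 ^ m) * (\<Sum>k<Suc m. const (t ^ k) * h k) \<in> I"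
        by (rule I(6)[OF Suc.prems(1) I(3)[OF Suc.prems(1)]])
      also have "(\<Sum>k<Suc m. const ((2 * t) ^ k) * h k) - const (2 ^ m) * (\<Sum>k<Suc m. const (t ^ k) * h k) =
          (\<Sum>k<Suc m. const (t ^ k) * g k)"
        unfolding sum_distrib_left sum_subtractf[symmetric] g_def
        by (rule sum.cong, simp, simp only: mult.assoc[symmetric] left_diff_distrib[symmetric]
            const_simps(4)[symmetric] const_simps(6)[symmetric])
           (simp add: power_mult_distrib algebra_simps del: const_simps)
      finally show ?thesis by (simp add: g_def)
    qed
    then have "g k \<in> I" by (rule Suc.IH) fact
    have "(of_nat (2 ^ k) :: complex) \<noteq> of_nat (2 ^ m)"
      using that unfolding of_nat_eq_iff by simp
    then show ?thesis
      by (intro two_sided_ideal_const_cancel[OF assms(1) \<open>g k \<in> I\<close>[unfolded g_def]]) simp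
  qed
  \<comment> \<open>The top coefficient is isolated by evaluation at \<open>t = 1\<close>.\<close>
  have "(\<Sum>k<Suc m. const (1 ^ k) * h k) - (\<Sum>k<m. h k) \<in> I"
    by (rule I(6)[OF Suc.prems(1) two_sided_ideal_sum[OF assms(1) *]]) simp
  then have "h m \<in> I" by simp
  with * Suc.prems(2) show ?case by (auto simp: less_Suc_eq)
qed simp

lemma subst_der_in_ideal_if_invariant:
  assumes "\<And>t. act (transvection x y t) f - f \<in> commutator_ideal m"
  shows "subst_der x y f \<in> commutator_ideal m"
proof -
  obtain M h where h: "h 0 = f" "h (Suc 0) = subst_der x y f"
    "\<And>t n. n \<ge> M \<Longrightarrow> act (transvection x y t) f = (\<Sum>k<n. const (t ^ k) * h k)"
    using act_transvection_expansion[of f x y] by blast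
  \<comment> \<open>Dropping the constant coefficient \<open>f\<close> gives the expansion of the
    difference in the hypothesis.\<close>
  define g where "g = h(0 := 0)"
  have "(\<Sum>k<Suc (Suc M). const (t ^ k) * g k) = act (transvection x y t) f - f" for t
    using h(3)[of "Suc (Suc M)" t] by (simp add: sum.lessThan_Suc_shift g_def h(1) del: sum.lessThan_Suc)
  then have "g (Suc 0) \<in> commutator_ideal m"
    using assms poly_coeff_in_ideal[OF two_sided_ideal_commutator_ideal[of m], of g "Suc (Suc M)" "Suc 0"]
    by (simp del: sum.lessThan_Suc)
  then show ?thesis by (simp add: g_def h)
qed

text \<open>One row operation on the identity, which keeps the determinant.\<close>

lemma transvection_in_SL:
  assumes "x \<noteq> y"
  shows "transvection x y t \<in> SL"
proof -
  have "transvection x y t =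
      (\<chi> k. if k = y then row y (mat 1) + t *s row x (mat 1) else row k (mat 1))"
    using assms by (auto simp: transvection_def vec_eq_iff row_def mat_def)
  then have "det (transvection x y t) = det (mat 1 :: complex^'a^'a)"
    using det_row_operation[of y x "mat 1" t] assms by simp
  then show ?thesis by (simp add: SL_def)
qed

text \<open>Such a set is a union of hyperbolic pairs, up to scaling.\<close>

definition hyperbolic :: "(complex^'n \<Rightarrow> complex^'n \<Rightarrow> complex) \<Rightarrow> (complex^'n::finite) set \<Rightarrow> bool" where
  "hyperbolic \<omega> B \<longleftrightarrow> (\<forall>u\<in>B. \<exists>v\<in>B. \<omega> u v \<noteq> 0 \<and> (\<forall>w\<in>B - {u}. \<omega> w v = 0))"

section \<open>Hyperbolic bases and symplectic transvections\<close>

context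
  fixes \<omega> :: "complex^'n::finite \<Rightarrow> complex^'n \<Rightarrow> complex"
  assumes \<omega>: "symplectic_form \<omega>"
begin

lemma form_left: "Vector_Spaces.linear (*s) (*) (\<lambda>u. \<omega> u v)"
  and form_right: "Vector_Spaces.linear (*s) (*) (\<omega> u)"
  and form_skew: "\<omega> u v = - \<omega> v u"
  and form_nondegenerate: "u \<noteq> 0 \<Longrightarrow> \<exists>v. \<omega> u v \<noteq> 0"
  using \<omega> unfolding symplectic_form_def by blast+

lemma form_simps:
  "\<omega> (u + u') v = \<omega> u v + \<omega> u' v" "\<omega> (c *s u) v = c * \<omega> u v" "\<omega> (u - u') v = \<omega> u v - \<omega> u' v"
  "\<omega> 0 v = 0"
  "\<omega> u (v + v') = \<omega> u v + \<omega> u v'" "\<omega> u (c *s v) = c * \<omega> u v" "\<omega> u (v - v') = \<omega> u v - \<omega> u v'"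
  "\<omega> u 0 = 0"
proof -
  interpret l: Vector_Spaces.linear "(*s)" "(*)" "\<lambda>u. \<omega> u v" by (rule form_left)
  interpret r: Vector_Spaces.linear "(*s)" "(*)" "\<omega> u" by (rule form_right)
  show "\<omega> (u + u') v = \<omega> u v + \<omega> u' v" "\<omega> (c *s u) v = c * \<omega> u v"
    "\<omega> (u - u') v = \<omega> u v - \<omega> u' v" "\<omega> 0 v = 0"
    by (rule l.add l.scale l.diff l.zero)+
  show "\<omega> u (v + v') = \<omega> u v + \<omega> u v'" "\<omega> u (c *s v) = c * \<omega> u v"
    "\<omega> u (v - v') = \<omega> u v - \<omega> u v'" "\<omega> u 0 = 0"
    by (rule r.add r.scale r.diff r.zero)+
qed

lemma form_sum_left: "\<omega> (\<Sum>i\<in>S. f i) v = (\<Sum>i\<in>S. \<omega> (f i) v)"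
  by (induction S rule: infinite_finite_induct) (auto simp: form_simps)

lemma form_self [simp]: "\<omega> u u = 0"
  using form_skew[of u u] by simp


text \<open>A partner of \<open>u\<close> is orthogonal to all other elements of \<open>B\<close>,
  so no two elements share a partner and \<open>y\<close> permutes the finite set
  \<open>B\<close>.\<close>

lemma hyperbolic_dual:
  assumes "hyperbolic \<omega> B" "finite B"
  obtains y where "y ` B = B" "\<And>u. u \<in> B \<Longrightarrow> \<omega> u (y u) \<noteq> 0"
    "\<And>u w. u \<in> B \<Longrightarrow> w \<in> B \<Longrightarrow> w \<noteq> u \<Longrightarrow> \<omega> w (y u) = 0"
proof -
  have "\<forall>u\<in>B. \<exists>v. v \<in> B \<and> \<omega> u v \<noteq> 0 \<and> (\<forall>w\<in>B - {u}. \<omega> w v = 0)"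
    using assms(1) unfolding hyperbolic_def by blast
  then obtain y where y: "\<And>u. u \<in> B \<Longrightarrow> y u \<in> B \<and> \<omega> u (y u) \<noteq> 0 \<and> (\<forall>w\<in>B - {u}. \<omega> w (y u) = 0)"
    by metis
  have "inj_on y B"
    by (rule inj_onI) (metis DiffI y singletonD)
  moreover have "y ` B \<subseteq> B" using y by blast
  ultimately have "y ` B = B" using endo_inj_surj assms(2) by blast
  with y that show ?thesis by blast
qed

lemma hyperbolic_independent:
  assumes "hyperbolic \<omega> B" "finite B"
  shows "vec.independent B"
proof -
  obtain y where y: "\<And>u. u \<in> B \<Longrightarrow> \<omega> u (y u) \<noteq> 0"
    "\<And>u w. u \<in> B \<Longrightarrow> w \<in> B \<Longrightarrow> w \<noteq> u \<Longrightarrow> \<omega> w (y u) = 0"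
    using hyperbolic_dual[OF assms] by metis
  have "c u = 0" if "(\<Sum>v\<in>B. c v *s v) = 0" "u \<in> B" for c u
  proof -
    have "0 = (\<Sum>v\<in>B. c v * \<omega> v (y u))"
      using arg_cong[OF that(1), of "\<lambda>v. \<omega> v (y u)"] by (simp add: form_sum_left form_simps)
    also have "\<dots> = (\<Sum>v\<in>B. if v = u then c u * \<omega> u (y u) else 0)"
      by (rule sum.cong) (auto simp: y(2)[OF that(2)])
    also have "\<dots> = c u * \<omega> u (y u)" using assms(2) that(2) by simp
    finally show ?thesis using y(1)[OF that(2)] by simp
  qed
  then show ?thesis using assms(2) by (auto simp: vec.dependent_finite)
qed

text \<open>\<open>s\<close> is the orthogonal projection of \<open>v\<close>, with coefficients
  read off by pairing with the partners. These exhaust \<open>B\<close>, so \<open>v - s\<close> is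
  orthogonal to all of it.\<close>

lemma hyperbolic_projection:
  assumes "hyperbolic \<omega> B" "finite B"
  obtains s where "s \<in> vec.span B" "\<And>z. z \<in> B \<Longrightarrow> \<omega> (v - s) z = 0"
proof -
  obtain y where y: "y ` B = B" "\<And>u. u \<in> B \<Longrightarrow> \<omega> u (y u) \<noteq> 0"
    "\<And>u w. u \<in> B \<Longrightarrow> w \<in> B \<Longrightarrow> w \<noteq> u \<Longrightarrow> \<omega> w (y u) = 0"
    using hyperbolic_dual[OF assms] by metis
  define s where "s = (\<Sum>u\<in>B. (\<omega> v (y u) / \<omega> u (y u)) *s u)"
  have "\<omega> (v - s) (y u) = 0" if "u \<in> B" for u
  proof -
    have "\<omega> s (y u) = (\<Sum>w\<in>B. if w = u then \<omega> v (y u) else 0)"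
      unfolding s_def form_sum_left form_simps
      by (rule sum.cong) (auto simp: y(3)[OF that] y(2)[OF that])
    then show ?thesis using assms(2) that by (simp add: form_simps)
  qed
  then have "\<omega> (v - s) z = 0" if "z \<in> B" for z
    using that y(1) by (metis imageE)
  moreover have "s \<in> vec.span B"
    unfolding s_def by (intro vec.span_sum vec.span_scale vec.span_base)
  ultimately show ?thesis using that by blast
qed

text \<open>A vector outside the span is made orthogonal to \<open>B\<close> by projection.
  Nondegeneracy supplies a partner, projected likewise, and the two form a new pair.\<close>

lemma hyperbolic_extend:
  assumes B: "hyperbolic \<omega> B" "finite B" and "vec.span B \<noteq> UNIV"
  obtains B' where "hyperbolic \<omega> B'" "finite B'" "card B < card B'"
proof -
  obtain v where v: "v \<notin> vec.span B" using assms(3) by blast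
  obtain s where s: "s \<in> vec.span B" "\<And>z. z \<in> B \<Longrightarrow> \<omega> (v - s) z = 0"
    using hyperbolic_projection[OF B] by blast
  define a where "a = v - s"
  have "a \<noteq> 0" using v s(1) by (auto simp: a_def)
  then obtain w where w: "\<omega> a w \<noteq> 0" using form_nondegenerate by blast
  obtain r where r: "r \<in> vec.span B" "\<And>z. z \<in> B \<Longrightarrow> \<omega> (w - r) z = 0"
    using hyperbolic_projection[OF B] by blast
  define b where "b = w - r"
  have a: "\<omega> a z = 0" "\<omega> z a = 0" if "z \<in> B" for z
    using s(2)[OF that] form_skew[of z a] by (simp_all add: a_def)
  have b: "\<omega> b z = 0" "\<omega> z b = 0" if "z \<in> B" for z
    using r(2)[OF that] form_skew[of z b] by (simp_all add: b_def)
  \<comment> \<open>Hence subtracting \<open>r\<close> from \<open>w\<close> does not change the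
    pairing with \<open>a\<close>.\<close>
  have "\<omega> a r = 0"
  proof -
    interpret Vector_Spaces.linear "(*s)" "(*)" "\<omega> a" by (rule form_right)
    show ?thesis using eq_0_on_span[OF a(1) r(1)] by blast
  qed
  then have ab: "\<omega> a b \<noteq> 0" "\<omega> b a \<noteq> 0"
    using w form_skew[of b a] by (simp_all add: b_def form_simps)
  have notin: "a \<notin> B" "b \<notin> B" using a b ab by blast+
  have "a \<noteq> b" using ab by auto
  show ?thesis
  proof (rule that[of "insert a (insert b B)"])
    show "hyperbolic \<omega> (insert a (insert b B))"
      unfolding hyperbolic_def
    proof
      fix u assume "u \<in> insert a (insert b B)"
      then consider "u = a" | "u = b" | "u \<in> B" by blast
      then show "\<exists>v\<in>insert a (insert b B). \<omega> u v \<noteq> 0 \<and> (\<forall>w\<in>insert a (insert b B) - {u}. \<omega> w v = 0)"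
      proof cases
        case 1
        then show ?thesis using ab b by (intro bexI[of _ b]) auto
      next
        case 2
        then show ?thesis using ab a by (intro bexI[of _ a]) auto
      next
        case 3
        then obtain v where "v \<in> B" "\<omega> u v \<noteq> 0" "\<forall>w\<in>B - {u}. \<omega> w v = 0"
          using B(1) unfolding hyperbolic_def by blast
        then show ?thesis using a b by (intro bexI[of _ v]) auto
      qed
    qed
    show "card B < card (insert a (insert b B))"
      using B(2) notin \<open>a \<noteq> b\<close> by simp
  qed (use B(2) in simp)
qed

text \<open>Independence bounds the size of hyperbolic sets; one of maximal cardinality spans by
  \<open>hyperbolic_extend\<close> and is then indexed by the variables.\<close>

lemma hyperbolic_basis_exists:
  obtains e :: "'n \<Rightarrow> complex^'n"
  where "\<And>x. \<exists>y. \<omega> (e x) (e y) \<noteq> 0 \<and> (\<forall>z. z \<noteq> x \<longrightarrow> \<omega> (e z) (e y) = 0)"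
proof -
  let ?P = "\<lambda>B. finite B \<and> hyperbolic \<omega> B"
  have bound: "card B < Suc CARD('n)" if "?P B" for B
    using vec.independent_card_le_dim[of B UNIV] hyperbolic_independent[of B] that
    unfolding vec_dim_card by simp
  have "?P {}" by (simp add: hyperbolic_def)
  then obtain B where B: "?P B" "\<And>B'. ?P B' \<Longrightarrow> card B' \<le> card B"
    using ex_has_greatest_nat[of ?P "{}" card "Suc CARD('n)"] bound by blast
  have "vec.span B = UNIV"
    using hyperbolic_extend[of B] B by (metis not_less)
  then have "card B = CARD('n)"
    using vec.basis_card_eq_dim[of B UNIV] hyperbolic_independent[of B] B(1)
    unfolding vec_dim_card by simp
  then obtain e where e: "bij_betw e (UNIV :: 'n set) B"
    using finite_same_card_bij[of "UNIV :: 'n set" B] B(1) by auto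
  show ?thesis
  proof (rule that)
    fix x
    have "e x \<in> B" using e by (auto simp: bij_betw_def)
    then obtain v where v: "v \<in> B" "\<omega> (e x) v \<noteq> 0" "\<forall>w\<in>B - {e x}. \<omega> w v = 0"
      using B(1) unfolding hyperbolic_def by blast
    obtain y where "v = e y" using e v(1) by (auto simp: bij_betw_def)
    moreover have "e z \<in> B - {e x}" if "z \<noteq> x" for z
      using e that by (auto simp: bij_betw_def inj_def)
    ultimately show "\<exists>y. \<omega> (e x) (e y) \<noteq> 0 \<and> (\<forall>z. z \<noteq> x \<longrightarrow> \<omega> (e z) (e y) = 0)"
      using v by blast
  qed
qed

text \<open>Pairing with \<open>e y\<close> reads off the coordinate \<open>x\<close> up to a
  scalar, so in the basis \<open>e\<close> the elementary transvection is the classical symplectic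
  transvection along \<open>e y\<close>.\<close>

lemma Sp_transvections:
  obtains b b' :: "complex^'n^'n"
  where "b ** b' = mat 1" "b' ** b = mat 1"
    "\<And>x. \<exists>y. y \<noteq> x \<and> (\<forall>t. b ** transvection x y t ** b' \<in> Sp \<omega>)"
proof -
  obtain e :: "'n \<Rightarrow> complex^'n"
    where e: "\<And>x. \<exists>y. \<omega> (e x) (e y) \<noteq> 0 \<and> (\<forall>z. z \<noteq> x \<longrightarrow> \<omega> (e z) (e y) = 0)"
    using hyperbolic_basis_exists by blast
  define b where "b = (\<chi> k i. e i $ k)"
  have b: "b *v v = (\<Sum>i\<in>UNIV. (v $ i) *s e i)" for v
    by (simp add: b_def matrix_vector_mult_def vec_eq_iff mult.commute)
  have b_axis: "b *v axis y 1 = e y" for y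
    by (simp add: vec_eq_iff matrix_vector_mult_axis_nth) (simp add: b_def)
  have coord: "\<omega> (b *v v) (e y) = v $ x * \<omega> (e x) (e y)"
    if "\<forall>z. z \<noteq> x \<longrightarrow> \<omega> (e z) (e y) = 0" for v x y
  proof -
    have "\<omega> (b *v v) (e y) = (\<Sum>i\<in>UNIV. if i = x then v $ x * \<omega> (e x) (e y) else 0)"
      unfolding b form_sum_left form_simps by (rule sum.cong) (use that in auto)
    then show ?thesis by simp
  qed
  have "v = 0" if "b *v v = 0" for v
  proof (subst vec_eq_iff, intro allI)
    fix x
    obtain y where y: "\<omega> (e x) (e y) \<noteq> 0" "\<forall>z. z \<noteq> x \<longrightarrow> \<omega> (e z) (e y) = 0"
      using e by blast
    show "v $ x = 0 $ x"
      using coord[OF y(2), of v] y(1) that by (simp add: form_simps)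
  qed
  then obtain b' where b': "b' ** b = mat 1"
    using matrix_left_invertible_ker[of b] by blast
  then have bb': "b ** b' = mat 1" by (simp add: matrix_left_right_inverse)
  show ?thesis
  proof (rule that[OF bb' b'])
    fix x
    obtain y where y: "\<omega> (e x) (e y) \<noteq> 0" "\<forall>z. z \<noteq> x \<longrightarrow> \<omega> (e z) (e y) = 0"
      using e by blast
    have "y \<noteq> x" using y(1) by auto
    moreover have "b ** transvection x y t ** b' \<in> Sp \<omega>" for t
    proof -
      \<comment> \<open>Normalized so that \<open>s * \<omega> w (e y)\<close> is \<open>t\<close>
        times the coordinate \<open>x\<close> of \<open>w\<close> in the basis
        \<open>e\<close>.\<close>
      define s where "s = t / \<omega> (e x) (e y)"
      have act: "(b ** transvection x y t ** b') *v w = w + (s * \<omega> w (e y)) *s e y" for w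
      proof -
        define v where "v = b' *v w"
        have w: "w = b *v v"
          by (simp add: v_def matrix_vector_mul_assoc bb')
        have "(b ** transvection x y t ** b') *v w = b *v (v + (t * v $ x) *s axis y 1)"
          by (simp add: v_def matrix_vector_mul_assoc[symmetric] transvection_mult_vec)
        also have "\<dots> = w + (t * v $ x) *s e y"
          by (simp add: matrix_vector_right_distrib vec.scale b_axis w)
        also have "t * v $ x = s * \<omega> w (e y)"
          using y(1) by (simp add: s_def w coord[OF y(2)])
        finally show ?thesis .
      qed
      have inv: "transvection x y t ** transvection x y (- t) = mat 1" for t
        using \<open>y \<noteq> x\<close> by (subst matrix_eq)
          (simp add: matrix_vector_mul_assoc[symmetric] transvection_mult_vec, simp add: axis_def)
      have "(b ** transvection x y t ** b') ** (b ** transvection x y (- t) ** b') = mat 1"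
        by (metis inv b' bb' matrix_mul_assoc matrix_mul_rid)
      then have "invertible (b ** transvection x y t ** b')"
        using invertible_right_inverse by blast
      \<comment> \<open>The cross terms cancel by skew symmetry, and the last term contains
        \<open>\<omega> (e y) (e y) = 0\<close>.\<close>
      moreover have "\<omega> (w + (s * \<omega> w (e y)) *s e y) (w' + (s * \<omega> w' (e y)) *s e y) = \<omega> w w'" for w w'
        using form_skew[of "e y" w'] by (simp add: form_simps algebra_simps)
      ultimately show ?thesis by (simp add: Sp_def act)
    qed
    ultimately show "\<exists>y. y \<noteq> x \<and> (\<forall>t. b ** transvection x y t ** b' \<in> Sp \<omega>)" by blast
  qed
qed

end

text \<open>For \<open>SL\<close> the standard basis serves; a second variable \<open>y\<close>
  exists there because n is at least 2.\<close>

lemma SL_or_Sp_transvections: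
  fixes G :: "(complex^'n::finite^'n) set"
  assumes "CARD('n) \<ge> 2" "G = SL \<or> (\<exists>s \<omega>. CARD('n) = 2 * s \<and> symplectic_form \<omega> \<and> G = Sp \<omega>)"
  obtains b b' :: "complex^'n^'n"
  where "b ** b' = mat 1" "b' ** b = mat 1"
    "\<And>x. \<exists>y. y \<noteq> x \<and> (\<forall>t. b ** transvection x y t ** b' \<in> G)"
proof -
  consider "G = SL" | \<omega> where "symplectic_form \<omega>" "G = Sp \<omega>" using assms(2) by blast
  then show ?thesis
  proof cases
    case 1
    have "\<exists>y. y \<noteq> x" for x :: 'n
      using assms(1) by (metis UNIV_I card_2_iff' ex_card subset_UNIV subsetD)
    then show ?thesis
      using 1 transvection_in_SL that[of "mat 1" "mat 1"] by (metis matrix_mul_lid matrix_mul_rid)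
  next
    case 2
    then show ?thesis using Sp_transvections that by metis
  qed
qed

lemma SL_or_Sp_invertible:
  assumes "G = SL \<or> (\<exists>s \<omega>. CARD('n) = 2 * s \<and> symplectic_form \<omega> \<and> G = Sp \<omega>)" "g \<in> G"
  shows "invertible (g :: complex^'n::finite^'n)"
  using assms by (auto simp: SL_def Sp_def invertible_det_nz)

section \<open>Invariants in the quotient\<close>

text \<open>The element is moved to the basis adapted to the transvections, truncated there and
  moved back; the action respects degrees and the ideal. The last conclusion serves the Hilbert
  series.\<close>

lemma invariant_truncation:
  fixes f :: "'n::finite free_algebra" and b b' :: "complex^'n^'n"
  assumes b: "b ** b' = mat 1" "b' ** b = mat 1"
    and G: "\<And>x. \<exists>y. y \<noteq> x \<and> (\<forall>t. b ** transvection x y t ** b' \<in> G)"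
    and inv: "\<And>g. g \<in> G \<Longrightarrow> act g f - f \<in> commutator_ideal (Suc p)"
  obtains h where "h \<in> up_to_degree (CARD('n) * (p - 1))" "f - h \<in> commutator_ideal (Suc p)"
    "\<And>d. f \<in> homogeneous d \<Longrightarrow> CARD('n) * (p - 1) < d \<Longrightarrow> h = 0"
proof -
  let ?N = "CARD('n) * (p - 1)"
  define f' where "f' = act b' f"
  define h where "h = word_filter (\<lambda>l. length l \<le> ?N) f'"
  have f: "f = act b f'" by (simp add: f'_def act_act b)
  have "\<exists>y. y \<noteq> x \<and> subst_der x y f' \<in> commutator_ideal (Suc p)" for x
  proof -
    obtain y where y: "y \<noteq> x" "\<And>t. b ** transvection x y t ** b' \<in> G" using G by blast
    have "act (transvection x y t) f' - f' \<in> commutator_ideal (Suc p)" for t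
    proof -
      \<comment> \<open>Conjugation turns invariance of \<open>f\<close> under \<open>G\<close> into
        invariance of \<open>f'\<close> under plain transvections.\<close>
      have "b' ** (b ** transvection x y t ** b') = transvection x y t ** b'"
        by (metis b(2) matrix_mul_assoc matrix_mul_lid)
      then have "act (transvection x y t) f' - f' = act b' (act (b ** transvection x y t ** b') f - f)"
        by (simp add: f'_def act_act act_diff)
      then show ?thesis using act_commutator_ideal[OF inv[OF y(2)]] by simp
    qed
    then show ?thesis using subst_der_in_ideal_if_invariant y(1) by blast
  qed
  then have "f' - h \<in> commutator_ideal (Suc p)"
    unfolding h_def by (rule diff_truncation_in_ideal)
  then have "f - act b h \<in> commutator_ideal (Suc p)"
    using act_commutator_ideal[of "f' - h"] by (simp add: f act_diff)
  moreover have "h \<in> up_to_degree ?N"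
    by (auto simp: h_def up_to_degree_def in_keys_iff lookup_word_filter split: if_splits)
  then have "act b h \<in> up_to_degree ?N" by (rule act_up_to_degree)
  moreover have "act b h = 0" if "f \<in> homogeneous d" "?N < d" for d
  proof -
    have "f' \<in> homogeneous d" unfolding f'_def using that(1) by (rule homogeneous_act)
    have "h = 0"
    proof (rule poly_mapping_eqI)
      fix w
      show "Poly_Mapping.lookup h w = Poly_Mapping.lookup 0 w"
        using \<open>f' \<in> homogeneous d\<close> that(2)
        by (cases "w \<in> Poly_Mapping.keys f'")
           (auto simp: h_def lookup_word_filter homogeneous_def not_in_keys_iff_lookup_eq_zero)
    qed
    then show ?thesis by simp
  qed
  ultimately show ?thesis using that by blast
qed

text \<open>Makes the quotient nontrivial for \<open>p \<ge> 1\<close>, so that its scalars form a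
  field.\<close>

lemma one_notin_commutator_ideal: "(1 :: 'n::finite free_algebra) \<notin> commutator_ideal (Suc (Suc m))"
proof -
  \<comment> \<open>the zero matrix acts as the augmentation\<close>
  have scalar: "\<exists>c. act (0 :: complex^'n^'n) f = const c" for f
  proof (induction f rule: free_algebra_induct)
    case zero
    show ?case by (auto intro: exI[of _ 0])
  next
    case (add f g)
    then show ?case by (metis act_add const_simps(3))
  next
    case (word c l)
    have "act (0 :: complex^'n^'n) (word l) = const (of_bool (l = []))"
      by (cases l) (simp_all add: word_Nil word_Cons act_mult act_var linear_form_def)
    then show ?case by (metis act_const_mult const_simps(4))
  qed
  have "commutator_ideal (Suc (Suc m)) \<subseteq> {f. act (0 :: complex^'n^'n) f = 0}"
  proof (rule commutator_ideal_minimal)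
    show "two_sided_ideal {f. act (0 :: complex^'n^'n) f = 0}"
      by (auto simp: two_sided_ideal_def act_add act_mult)
    fix us :: "'n free_algebra list" assume "length us = Suc (Suc m)"
    then obtain vs c where vs: "us = vs @ [c]" "vs \<noteq> []"
      by (metis length_Suc_conv_rev length_0_conv nat.distinct(1))
    then show "left_normed_commutator us \<in> {f. act (0 :: complex^'n^'n) f = 0}"
      using scalar[of c] by (auto simp: left_normed_commutator_snoc act_diff act_mult const_commute)
  qed
  then show ?thesis by force
qed

section \<open>Cosets, scalars and the induced action\<close>

lemma ideal_commutator_ideal: "ideal (commutator_ideal m) ring_of_type_algebra"
  by (simp add: ideal_iff_two_sided_ideal two_sided_ideal_commutator_ideal)

lemma mem_rel_free_proj: "x \<in> rel_free_proj p f \<longleftrightarrow> x - f \<in> commutator_ideal (Suc p)"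
  unfolding rel_free_proj_def a_r_coset_def r_coset_def
  by (auto intro!: bexI[of _ "x - f"])

lemma rel_free_proj_eq_iff:
  "rel_free_proj p f = rel_free_proj p h \<longleftrightarrow> f - h \<in> commutator_ideal (Suc p)"
proof
  note I = two_sided_idealD[OF two_sided_ideal_commutator_ideal[of "Suc p"]]
  show "f - h \<in> commutator_ideal (Suc p)" if "rel_free_proj p f = rel_free_proj p h"
    using that mem_rel_free_proj[of f p f] mem_rel_free_proj[of f p h] I(1) by simp
  assume fh: "f - h \<in> commutator_ideal (Suc p)"
  have "x - f \<in> commutator_ideal (Suc p) \<longleftrightarrow> x - h \<in> commutator_ideal (Suc p)" for x
    using I(2)[OF _ fh, of "x - f"] I(6)[OF _ fh, of "x - h"] by auto
  then show "rel_free_proj p f = rel_free_proj p h"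
    by (auto simp: mem_rel_free_proj)
qed

lemma ring_hom_rel_free_proj: "ring_hom_ring ring_of_type_algebra (rel_free p) (rel_free_proj p)"
  unfolding rel_free_def rel_free_proj_def
  by (rule ideal.rcos_ring_hom_ring[OF ideal_commutator_ideal])

lemma carrier_rel_free: "carrier (rel_free p) = range (rel_free_proj p)"
  by (auto simp: rel_free_def FactRing_def A_RCOSETS_def' rel_free_proj_def)

lemma zero_rel_free: "\<zero>\<^bsub>rel_free p\<^esub> = rel_free_proj p 0"
  by (auto simp: rel_free_def FactRing_def mem_rel_free_proj)

lemma subfield_range_const: "subfield (range const) (ring_of_type_algebra :: 'n free_algebra ring)"
proof -
  let ?R = "ring_of_type_algebra :: 'n free_algebra ring"
  interpret R: ring ?R by (rule ring_ring_of_type_algebra)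
  have inv: "\<ominus>\<^bsub>?R\<^esub> a = - a" for a :: "'n free_algebra"
    by (rule R.minus_equality) auto
  show ?thesis
  proof (rule R.subfieldI)
    show "subcring (range const) ?R"
    proof (rule R.subcringI[OF R.subringI])
      show "\<one>\<^bsub>?R\<^esub> \<in> range const"
        using const_simps(2) by (metis rangeI ring_of_type_algebra_simps(4))
      show "\<ominus>\<^bsub>?R\<^esub> h \<in> range const" if "h \<in> range const" for h
        using that by (auto simp: inv simp flip: const_simps(5))
      show "h \<otimes>\<^bsub>?R\<^esub> k \<in> range const" "h \<oplus>\<^bsub>?R\<^esub> k \<in> range const"
        if "h \<in> range const" "k \<in> range const" for h k
        using that by (auto simp flip: const_simps(3,4))
      show "h \<otimes>\<^bsub>?R\<^esub> k = k \<otimes>\<^bsub>?R\<^esub> h" if "h \<in> range const" for h k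
        using that by (auto intro: const_commute)
    qed simp
    have "\<exists>y. const x * const y = (1 :: 'n free_algebra)" if "const x \<noteq> (0 :: 'n free_algebra)" for x
    proof -
      from that have "x \<noteq> 0" by auto
      then show ?thesis
        by (metis const_simps(2,4) right_inverse)
    qed
    then have "\<exists>y. const y * const x = (1 :: 'n free_algebra) \<and> const x * const y = (1 :: 'n free_algebra)"
      if "const x \<noteq> (0 :: 'n free_algebra)" for x
      using that by (metis const_commute)
    then show "Units (?R\<lparr>carrier := range const\<rparr>) = range const - {\<zero>\<^bsub>?R\<^esub>}"
      by (auto simp: Units_def)
  qed
qed

lemma subfield_rel_free_scalars:
  assumes "p \<ge> 1"
  shows "subfield (rel_free_scalars p) (rel_free p :: 'n::finite free_algebra set ring)"
proof -
  interpret ring_hom_ring "ring_of_type_algebra :: 'n free_algebra ring" "rel_free p" "rel_free_proj p"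
    by (rule ring_hom_rel_free_proj)
  obtain m where m: "p = Suc m" using assms by (cases p) auto
  have "rel_free_proj p (1 :: 'n free_algebra) \<noteq> rel_free_proj p 0"
    using one_notin_commutator_ideal[of m, where 'n = 'n] by (simp add: rel_free_proj_eq_iff m)
  then have "\<one>\<^bsub>rel_free p\<^esub> \<noteq> (\<zero>\<^bsub>rel_free p\<^esub> :: 'n free_algebra set)"
    using hom_one by (simp add: zero_rel_free)
  then show ?thesis
    unfolding rel_free_scalars_def by (rule img_is_subfield(2)[OF subfield_range_const])
qed

text \<open>The inverse matrix provides preimages, so the image of a coset is a full coset.\<close>

lemma act_image_rel_free_proj:
  assumes "invertible g"
  shows "act g ` rel_free_proj p f = rel_free_proj p (act g f)"
proof (intro equalityI subsetI)
  fix x assume "x \<in> act g ` rel_free_proj p f"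
  then show "x \<in> rel_free_proj p (act g f)"
    by (auto simp: mem_rel_free_proj simp flip: act_diff intro: act_commutator_ideal)
next
  fix x assume x: "x \<in> rel_free_proj p (act g f)"
  obtain g' where g': "g ** g' = mat 1" "g' ** g = mat 1"
    using assms by (auto simp: invertible_def)
  have "act g' x - f = act g' (x - act g f)"
    by (simp add: act_diff act_act g')
  then have "act g' x \<in> rel_free_proj p f"
    using x by (simp add: mem_rel_free_proj act_commutator_ideal)
  moreover have "x = act g (act g' x)" by (simp add: act_act g')
  ultimately show "x \<in> act g ` rel_free_proj p f" by blast
qed

lemma rel_free_invariants_iff:
  assumes "\<forall>g\<in>G. invertible g"
  shows "rel_free_proj p f \<in> rel_free_invariants p G \<longleftrightarrow>
    (\<forall>g\<in>G. act g f - f \<in> commutator_ideal (Suc p))"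
  by (auto simp: rel_free_invariants_def carrier_rel_free act_image_rel_free_proj assms rel_free_proj_eq_iff)

text \<open>\<open>subalgebra\<close> means a linear subspace over the scalars here, and the
  congruences expressing invariance are linear in the representative.\<close>

lemma subalgebra_rel_free_invariants:
  fixes G :: "(complex^'n::finite^'n) set"
  assumes "\<forall>g\<in>G. invertible g"
  shows "subalgebra (rel_free_scalars p) (rel_free_invariants p G) (rel_free p)"
proof -
  interpret ring_hom_ring "ring_of_type_algebra :: 'n free_algebra ring" "rel_free p" "rel_free_proj p"
    by (rule ring_hom_rel_free_proj)
  note I = two_sided_idealD[OF two_sided_ideal_commutator_ideal[of "Suc p"]]
  note iff = rel_free_invariants_iff[OF assms]
  let ?V = "rel_free_invariants p G"
  have V: "\<exists>f. A = rel_free_proj p f" if "A \<in> ?V" for A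
    using that by (auto simp: rel_free_invariants_def carrier_rel_free)
  have add: "rel_free_proj p (f + h) \<in> ?V" if "rel_free_proj p f \<in> ?V" "rel_free_proj p h \<in> ?V" for f h
  proof -
    have eq: "act g (f + h) - (f + h) = (act g f - f) + (act g h - h)" for g
      by (simp add: act_add)
    show ?thesis using that I(2) unfolding iff eq by blast
  qed
  have scale: "rel_free_proj p (const c * f) \<in> ?V" if "rel_free_proj p f \<in> ?V" for c f
  proof -
    have eq: "act g (const c * f) - const c * f = const c * (act g f - f)" for g
      by (simp add: act_const_mult right_diff_distrib)
    show ?thesis using that I(3) unfolding iff eq by blast
  qed
  have hom: "rel_free_proj p f \<oplus>\<^bsub>rel_free p\<^esub> rel_free_proj p h = rel_free_proj p (f + h)"
    "rel_free_proj p f \<otimes>\<^bsub>rel_free p\<^esub> rel_free_proj p h = rel_free_proj p (f * h)"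
    for f h :: "'n free_algebra"
    using hom_add[of f h] hom_mult[of f h] by simp_all
  show ?thesis
  proof (intro subalgebra.intro subalgebra_axioms.intro)
    show "subgroup ?V (add_monoid (rel_free p))"
    proof (rule S.add.subgroupI)
      show "?V \<subseteq> carrier (rel_free p)" by (auto simp: rel_free_invariants_def)
      have "rel_free_proj p 0 \<in> ?V" by (simp add: iff I(1))
      then show "?V \<noteq> {}" by blast
    next
      fix A assume A: "A \<in> ?V"
      then obtain f where f: "A = rel_free_proj p f" using V by blast
      have "rel_free_proj p (const (- 1) * f) \<in> ?V" using scale A f by blast
      moreover have "\<ominus>\<^bsub>rel_free p\<^esub> A = rel_free_proj p (const (- 1) * f)"
        by (rule S.minus_equality) (auto simp: f hom zero_rel_free carrier_rel_free)
      ultimately show "\<ominus>\<^bsub>rel_free p\<^esub> A \<in> ?V" by simp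
    next
      fix A B assume "A \<in> ?V" "B \<in> ?V"
      then show "A \<oplus>\<^bsub>rel_free p\<^esub> B \<in> ?V"
        using V[of A] V[of B] add by (auto simp: hom)
    qed
  next
    fix k A :: "'n free_algebra set" assume "k \<in> rel_free_scalars p" "A \<in> ?V"
    then show "k \<otimes>\<^bsub>rel_free p\<^esub> A \<in> ?V"
      using V[of A] scale by (auto simp: hom rel_free_scalars_def)
  qed
qed

text \<open>Over a finite alphabet only finitely many words have length at most \<open>N\<close>;
  their classes serve as \<open>Us\<close>.\<close>

lemma up_to_degree_subset_Span:
  assumes "p \<ge> 1"
  obtains Us :: "'n::finite free_algebra set list"
  where "set Us \<subseteq> carrier (rel_free p)"
    "rel_free_proj p ` up_to_degree N \<subseteq> ring.Span (rel_free p) (rel_free_scalars p) Us"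
proof -
  interpret ring_hom_ring "ring_of_type_algebra :: 'n free_algebra ring" "rel_free p" "rel_free_proj p"
    by (rule ring_hom_rel_free_proj)
  note K = subfield_rel_free_scalars[OF assms, where 'n = 'n]
  have "finite {l :: 'n list. set l \<subseteq> UNIV \<and> length l \<le> N}"
    by (rule finite_lists_length_le) simp
  then obtain Ls where Ls: "set Ls = {l :: 'n list. length l \<le> N}"
    using finite_list by auto
  define Us where "Us = map (\<lambda>l. rel_free_proj p (word l)) Ls"
  have Us: "set Us \<subseteq> carrier (rel_free p)"
    by (auto simp: Us_def carrier_rel_free)
  note Span = S.Span_is_subalgebra[OF K Us]
  interpret Span: subalgebra "rel_free_scalars p" "S.Span (rel_free_scalars p) Us" "rel_free p"
    by (rule Span)
  have "rel_free_proj p (\<Sum>w\<in>T. const (c w) * word (letters w)) \<in> S.Span (rel_free_scalars p) Us"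
    if "\<And>w. w \<in> T \<Longrightarrow> length (letters w) \<le> N" for T and c :: "'n free_monoid \<Rightarrow> complex"
    using that
  proof (induction T rule: infinite_finite_induct)
    case (insert w T)
    have "rel_free_proj p (word (letters w)) \<in> set Us"
      using insert.prems[of w] Ls by (cases w) (auto simp: Us_def)
    then have "rel_free_proj p (word (letters w)) \<in> S.Span (rel_free_scalars p) Us"
      using S.Span_base_incl[OF K Us] by blast
    then have "rel_free_proj p (const (c w)) \<otimes>\<^bsub>rel_free p\<^esub> rel_free_proj p (word (letters w))
        \<in> S.Span (rel_free_scalars p) Us"
      by (rule Span.smult_closed[rotated]) (simp add: rel_free_scalars_def)
    then have 1: "rel_free_proj p (const (c w) * word (letters w)) \<in> S.Span (rel_free_scalars p) Us"
      using hom_mult[of "const (c w)" "word (letters w)"] by simp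
    have 2: "rel_free_proj p (\<Sum>w\<in>T. const (c w) * word (letters w)) \<in> S.Span (rel_free_scalars p) Us"
      using insert by blast
    show ?case
      using Span.m_closed[OF 1 2] insert.hyps
        hom_add[of "const (c w) * word (letters w)" "\<Sum>w\<in>T. const (c w) * word (letters w)"]
      by simp
  qed (use Span.one_closed in \<open>simp_all add: zero_rel_free\<close>)
  then have "rel_free_proj p f \<in> S.Span (rel_free_scalars p) Us" if "f \<in> up_to_degree N" for f
    using that by (subst free_algebra_decomp[of f]) (auto simp only: up_to_degree_def mem_Collect_eq)
  with Us that show ?thesis by blast
qed

section \<open>Finite dimension and the Hilbert series\<close>

theorem proposition4p1:
  fixes p :: nat and G :: "(complex^'n::finite^'n) set"
  assumes "CARD('n) \<ge> 2"
    and "p \<ge> 1"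
    and "G = SL \<or> (\<exists>s \<omega>. CARD('n) = 2 * s \<and> symplectic_form \<omega> \<and> G = Sp \<omega>)"
  shows "ring.finite_dimension (rel_free p) (rel_free_scalars p) (rel_free_invariants p G) \<and>
    (\<exists>h :: int poly. fps_of_poly h = hilbert_series_invariants p G \<and>
       Polynomial.degree h \<le> CARD('n) * (p - 1))"
proof
  let ?N = "CARD('n) * (p - 1)" and ?K = "rel_free_scalars p :: 'n free_algebra set set"
  let ?V = "rel_free_invariants p G"
  interpret ring_hom_ring "ring_of_type_algebra :: 'n free_algebra ring" "rel_free p" "rel_free_proj p"
    by (rule ring_hom_rel_free_proj)
  have inv: "\<forall>g\<in>G. invertible g"
    using SL_or_Sp_invertible[OF assms(3)] by blast
  note K = subfield_rel_free_scalars[OF assms(2), where 'n = 'n]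
    and iff = rel_free_invariants_iff[OF inv, of p]
  obtain b b' :: "complex^'n^'n" where b: "b ** b' = mat 1" "b' ** b = mat 1"
    "\<And>x. \<exists>y. y \<noteq> x \<and> (\<forall>t. b ** transvection x y t ** b' \<in> G)"
    using SL_or_Sp_transvections[OF assms(1,3)] by blast
  have trunc: "\<exists>h \<in> up_to_degree ?N. f - h \<in> commutator_ideal (Suc p) \<and>
      (\<forall>d. f \<in> homogeneous d \<longrightarrow> ?N < d \<longrightarrow> h = 0)" if f: "rel_free_proj p f \<in> ?V" for f
  proof -
    obtain h where "h \<in> up_to_degree ?N" "f - h \<in> commutator_ideal (Suc p)"
      "\<And>d. f \<in> homogeneous d \<Longrightarrow> ?N < d \<Longrightarrow> h = 0"
      using invariant_truncation[OF b, of f p] f[unfolded iff] by blast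
    then show ?thesis by blast
  qed
  obtain Us :: "'n free_algebra set list" where Us: "set Us \<subseteq> carrier (rel_free p)"
    "rel_free_proj p ` up_to_degree ?N \<subseteq> S.Span ?K Us"
    using up_to_degree_subset_Span[OF assms(2)] by blast
  \<comment> \<open>Every invariant class has a representative of bounded degree, so the invariants
    lie in a finite-dimensional span.\<close>
  have "?V \<subseteq> S.Span ?K Us"
  proof
    fix A assume A: "A \<in> ?V"
    then obtain f where f: "A = rel_free_proj p f"
      by (auto simp: rel_free_invariants_def carrier_rel_free)
    then obtain h where "h \<in> up_to_degree ?N" "A = rel_free_proj p h"
      using trunc[of f] A by (auto simp: rel_free_proj_eq_iff)
    then show "A \<in> S.Span ?K Us" using Us(2) by blast
  qed
  then show "S.finite_dimension ?K ?V"
    by (rule S.subalbegra_incl_imp_finite_dimension[OF K S.Span_finite_dimension[OF K Us(1)]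
          subalgebra_rel_free_invariants[OF inv]])
  define c where "c d = S.dim ?K (rel_free_component p d \<inter> ?V)" for d
  have "c d = 0" if "?N < d" for d
  proof -
    \<comment> \<open>Above the bound, the truncation of a homogeneous representative is 0, so its
      class is zero.\<close>
    have "rel_free_component p d \<inter> ?V \<subseteq> {\<zero>\<^bsub>rel_free p\<^esub>}"
    proof
      fix A assume A: "A \<in> rel_free_component p d \<inter> ?V"
      then obtain f where f: "A = rel_free_proj p f" "f \<in> homogeneous d"
        by (auto simp: rel_free_component_def)
      then show "A \<in> {\<zero>\<^bsub>rel_free p\<^esub>}"
        using trunc[of f] A that by (auto simp: zero_rel_free rel_free_proj_eq_iff)
    qed
    moreover have "\<zero>\<^bsub>rel_free p\<^esub> \<in> rel_free_component p d \<inter> ?V"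
      using iff[of 0] two_sided_idealD(1)[OF two_sided_ideal_commutator_ideal]
      by (auto simp: zero_rel_free rel_free_component_def homogeneous_def)
    ultimately have "rel_free_component p d \<inter> ?V = {\<zero>\<^bsub>rel_free p\<^esub>}" by blast
    then show ?thesis
      using S.dimI[OF K S.dimension.zero_dim] by (simp add: c_def over_def)
  qed
  \<comment> \<open>The coefficients above the bound vanish, so the finite sum is the whole
    series.\<close>
  then have "fps_of_poly (\<Sum>d\<le>?N. Polynomial.monom (int (c d)) d) = hilbert_series_invariants p G"
    by (auto simp: fps_eq_iff hilbert_series_invariants_def coeff_sum c_def[symmetric])
  moreover have "Polynomial.degree (\<Sum>d\<le>?N. Polynomial.monom (int (c d)) d) \<le> ?N"
    by (intro degree_sum_le) (auto intro: order.trans[OF degree_monom_le])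
  ultimately show "\<exists>h :: int poly. fps_of_poly h = hilbert_series_invariants p G \<and>
       Polynomial.degree h \<le> ?N"
    by blast
qed

end
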